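(* Let $P_\theta^{(n)}$ be the distribution on $C[0,1]$ of the solution of the diffusion equation $dX_t=\theta(t)\,dt+n^{-1/2}\,dW_t$ with $X_0=0$. Suppose that for $\varepsilon_n\to0$ ($\varepsilon_n>0$), $(n\varepsilon_n^2)^{-1}=O(1)$ and $\Theta\subset L_2[0,1]$, the following conditions are satisfied: $$\sup_{\varepsilon>\varepsilon_n}\log N\bigl(\varepsilon/8,\{\theta\in\Theta:\|\theta-\theta_0\|<\varepsilon\},\|\cdot\|\bigr)\le n\varepsilon_n^2;$$ for every $j\in\mathbb{N}$, $$\frac{\Pi_n(\theta\in\Theta:\|\theta-\theta_0\|\le j\varepsilon_n)}{\Pi_n(\theta\in\Theta:\|\theta-\theta_0\|\le\varepsilon_n)}\le e^{n\varepsilon_n^2j^2/64}.$$ Then $P_{\theta_0}^{(n)}\Pi_n(\theta\in\Theta:\|\theta-\theta_0\|\ge M_n\varepsilon_n\mid X^{(n)})\to0$ for every $M_n\to\infty$.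
   Context: White noise model: $\theta\in\Theta\subset L_2[0,1]$, and the observation is the process $X^{(n)}=(X_t^{(n)}:0\le t\le1)$ with $X_t^{(n)}=\int_0^t\theta(s)\,ds+n^{-1/2}W_t$ for a standard Brownian motion $W$. $\|\cdot\|$ is the $L_2[0,1]$-norm. $\Pi_n$ is a prior probability measure on $\Theta$, $\Pi_n(\cdot\mid X^{(n)})$ the posterior distribution given by Bayes' formula, $\theta_0\in\Theta$ the fixed true parameter, and $Pf=\int f\,dP$. $N(\varepsilon,A,\|\cdot\|)$ is the minimal number of $\|\cdot\|$-balls of radius $\varepsilon$ needed to cover $A$. *)

theory Defs
  imports "HOL-Probability.Probability"
begin

(* L2[0,1] is represented by square-integrable functions rather than by their classes modulo
   null sets. l2_dist only depends on the classes; values outside [0,1] are irrelevant. *)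

definition L2_01 :: "(real \<Rightarrow> real) set" where
  "L2_01 = {f. f \<in> borel_measurable (lebesgue_on {0..1}) \<and>
               integrable (lebesgue_on {0..1}) (\<lambda>s. (f s)\<^sup>2)}"

definition l2_norm :: "(real \<Rightarrow> real) \<Rightarrow> real" where
  "l2_norm f = sqrt (\<integral>s. (f s)\<^sup>2 \<partial>lebesgue_on {0..1})"

definition l2_dist :: "(real \<Rightarrow> real) \<Rightarrow> (real \<Rightarrow> real) \<Rightarrow> real" where
  "l2_dist f g = l2_norm (\<lambda>s. f s - g s)"

(* Balls are open with centres anywhere in L2[0,1]; the value is infinity if no finite cover exists. *)
definition l2_covering_number :: "real \<Rightarrow> (real \<Rightarrow> real) set \<Rightarrow> enat" where
  "l2_covering_number r A =
     (INF F \<in> {F. finite F \<and> F \<subseteq> L2_01 \<and> A \<subseteq> (\<Union>c\<in>F. {f \<in> L2_01. l2_dist f c < r})}. enat (card F))"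

definition ln_enat :: "enat \<Rightarrow> ereal" where
  "ln_enat N = (case N of enat k \<Rightarrow> if k = 0 then - \<infinity> else ereal (ln (real k)) | \<infinity> \<Rightarrow> \<infinity>)"

locale standard_brownian_motion = prob_space M
  for M :: "'w measure" +
  fixes W :: "real \<Rightarrow> 'w \<Rightarrow> real"
  assumes measurable_W: "\<And>t. t \<in> {0..1} \<Longrightarrow> W t \<in> borel_measurable M"
    and starts_at_0: "\<And>\<omega>. \<omega> \<in> space M \<Longrightarrow> W 0 \<omega> = 0"
    and continuous_paths: "\<And>\<omega>. \<omega> \<in> space M \<Longrightarrow> continuous_on {0..1} (\<lambda>t. W t \<omega>)"
    and gaussian_increments: "\<And>s t. 0 \<le> s \<Longrightarrow> s < t \<Longrightarrow> t \<le> 1 \<Longrightarrow>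
      distributed M lborel (\<lambda>\<omega>. W t \<omega> - W s \<omega>) (normal_density 0 (sqrt (t - s)))"
    and independent_increments: "\<And>(k::nat) \<tau>. \<tau> ` {..k} \<subseteq> {0..1} \<Longrightarrow> mono_on {..k} \<tau> \<Longrightarrow>
      indep_vars (\<lambda>_. borel) (\<lambda>i \<omega>. W (\<tau> (Suc i)) \<omega> - W (\<tau> i) \<omega>) {..<k}"

(* C[0,1], as functions equal to undefined outside [0,1]. The sigma-algebra generated by the
   coordinate maps is the Borel sigma-algebra of the uniform norm. *)
definition C01 :: "(real \<Rightarrow> real) measure" where
  "C01 = restrict_space (Pi\<^sub>M {0..1} (\<lambda>_. borel)) {x. continuous_on {0..1} x}"

definition white_noise_path ::
    "(real \<Rightarrow> 'w \<Rightarrow> real) \<Rightarrow> nat \<Rightarrow> (real \<Rightarrow> real) \<Rightarrow> 'w \<Rightarrow> real \<Rightarrow> real" where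
  "white_noise_path W n \<theta> \<omega> = (\<lambda>t\<in>{0..1}. (\<integral>s. \<theta> s \<partial>lebesgue_on {0..t}) + W t \<omega> / sqrt (real n))"

definition white_noise_law ::
    "'w measure \<Rightarrow> (real \<Rightarrow> 'w \<Rightarrow> real) \<Rightarrow> nat \<Rightarrow> (real \<Rightarrow> real) \<Rightarrow> (real \<Rightarrow> real) measure" where
  "white_noise_law M W n \<theta> = distr M C01 (white_noise_path W n \<theta>)"

(* Densities p of the model P with respect to a sigma-finite measure mu, jointly measurable in
   parameter and observation; this is what Bayes' formula requires. *)
definition model_densities ::
    "'x measure \<Rightarrow> 't measure \<Rightarrow> ('t \<Rightarrow> 'x measure) \<Rightarrow> ('t \<Rightarrow> 'x \<Rightarrow> ennreal) \<Rightarrow> bool" where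
  "model_densities \<mu> prior P p \<longleftrightarrow>
     sigma_finite_measure \<mu> \<and>
     (\<lambda>(\<theta>, x). p \<theta> x) \<in> borel_measurable (prior \<Otimes>\<^sub>M \<mu>) \<and>
     (\<forall>\<theta> \<in> space prior. P \<theta> = density \<mu> (p \<theta>))"

definition posterior :: "'t measure \<Rightarrow> ('t \<Rightarrow> 'x \<Rightarrow> ennreal) \<Rightarrow> 'x \<Rightarrow> 't measure" where
  "posterior prior p x = density prior (\<lambda>\<theta>. p \<theta> x / (\<integral>\<^sup>+\<theta>'. p \<theta>' x \<partial>prior))"

end

(* Two facts about the white noise laws P_theta carry the proof.

   (1) P_theta0(E)^2 <= exp(n |theta - theta0|^2) P_theta(E) for all events E. On cylinder events this is
   Cauchy-Schwarz for two products of normal laws of increments, and both sides are continuous along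
   monotone sequences of events, so the monotone class theorem extends it; no Girsanov formula is needed.
   Averaging over the prior on B = {|theta - theta0| <= eps} shows that the integral over B of p_theta
   exceeds exp(-C n eps^2) Pi(B) p_theta0 except on an event of P_theta0-probability at most
   exp(-(C - 1) n eps^2), which bounds the denominator in Bayes' formula from below.

   (2) For a step function h the functional <h, X> is Gaussian with mean <h, theta> and variance |h|^2 / n.
   With h close to c - theta0, it yields a test of theta0 against a ball around c. Testing against all balls
   of a cover of the shell j eps <= |theta - theta0| < (j + 1) eps gives errors at most
   exp(n eps^2 - n eps^2 j^2 / 32) and exp(-n eps^2 j^2 / 32).

   The shell has prior mass at most exp(n eps^2 (j + 1)^2 / 64) Pi(B), so for fixed C the sum over j >= M of
   all error terms tends to 0 as M grows, uniformly in n with n eps^2 bounded below. Finally C tends to infinity. *)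

theory Submission
  imports Defs "HOL-Real_Asymp.Real_Asymp"
begin

section \<open>Preliminaries on measures and Gaussian densities\<close>

text \<open>The densities \<open>p n\<close> are arbitrary versions with respect to an arbitrary
  dominating measure, so all estimates are stated for probabilities of events instead of
  likelihoods. The factor exp(n |theta - theta0|^2) in (1) is the second moment of
  dP_theta0/dP_theta under P_theta; on B it is at most exp(n eps^2).

  The obstacle is that n eps^2 is only bounded below and need not tend to infinity. The event on
  which the denominator is small need not become negligible for fixed C, which is why C is a free
  parameter.

  The constants 1/32 and 1/64 leave room for this: the exponent of a shell is n eps^2 times C + (j +
  1)^2 / 64 - j^2 / 32, and the surplus of about j^2 / 64 absorbs C once j is large. As for the
  cover, a ball of radius (j + 1) eps / 8 that meets the shell has its centre at distance at least j
  eps - (j + 1) eps / 8 from theta0, so a test of theta0 against the centre still has enough margin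
  for the whole ball.\<close>

lemma monotone_class_sigma_sets:
  assumes alg: "algebra \<Omega> A" and AC: "A \<subseteq> C"
    and inc: "\<And>F :: nat \<Rightarrow> 'a set. range F \<subseteq> C \<Longrightarrow> incseq F \<Longrightarrow> (\<Union>i. F i) \<in> C"
    and dec: "\<And>F :: nat \<Rightarrow> 'a set. range F \<subseteq> C \<Longrightarrow> decseq F \<Longrightarrow> (\<Inter>i. F i) \<in> C"
  shows "sigma_sets \<Omega> A \<subseteq> C"
proof -
  interpret algebra \<Omega> A by fact
  define mono_class where "mono_class D \<longleftrightarrow>
    (\<forall>F :: nat \<Rightarrow> 'a set. range F \<subseteq> D \<longrightarrow> incseq F \<longrightarrow> (\<Union>i. F i) \<in> D) \<and>
    (\<forall>F :: nat \<Rightarrow> 'a set. range F \<subseteq> D \<longrightarrow> decseq F \<longrightarrow> (\<Inter>i. F i) \<in> D)" for D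
  \<comment> \<open>The smallest monotone class containing \<open>A\<close>. It turns out to be
    closed under complements and countable unions, hence to contain
    \<open>sigma_sets \<Omega> A\<close>.\<close>
  define m where "m = \<Inter>{D. A \<subseteq> D \<and> mono_class D}"
  have m_least: "m \<subseteq> D" if "A \<subseteq> D" "mono_class D" for D
    using that unfolding m_def by blast
  have Am: "A \<subseteq> m" unfolding m_def by blast
  have m_inc: "(\<Union>i. F i) \<in> m" if "range F \<subseteq> m" "incseq F" for F :: "nat \<Rightarrow> 'a set"
    unfolding m_def
  proof (intro InterI, clarify)
    fix D assume "A \<subseteq> D" and "mono_class D"
    then have "range F \<subseteq> D" using m_least that(1) by blast
    with \<open>mono_class D\<close> that(2) show "(\<Union>i. F i) \<in> D" unfolding mono_class_def by blast
  qed
  have m_dec: "(\<Inter>i. F i) \<in> m" if "range F \<subseteq> m" "decseq F" for F :: "nat \<Rightarrow> 'a set"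
    unfolding m_def
  proof (intro InterI, clarify)
    fix D assume "A \<subseteq> D" and "mono_class D"
    then have "range F \<subseteq> D" using m_least that(1) by blast
    with \<open>mono_class D\<close> that(2) show "(\<Inter>i. F i) \<in> D" unfolding mono_class_def by blast
  qed
  \<comment> \<open>The sets that combine well with \<open>E\<close>. The condition is symmetric in
    \<open>E\<close> and \<open>F\<close>, so the inclusion for \<open>E\<close> in \<open>A\<close>
    (\<open>K1\<close>) can be read the other way round and gives the one for \<open>E\<close> in
    \<open>m\<close> (\<open>K2\<close>).\<close>
  define K where "K E = {F. E \<inter> F \<in> m \<and> E - F \<in> m \<and> F - E \<in> m}" for E
  have mono_K: "mono_class (K E)" for E
    unfolding mono_class_def
  proof (intro conjI allI impI)
    fix F :: "nat \<Rightarrow> 'a set" assume F: "range F \<subseteq> K E" "incseq F"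
    have "(\<Union>i. E \<inter> F i) \<in> m" "(\<Inter>i. E - F i) \<in> m" "(\<Union>i. F i - E) \<in> m"
      by (intro m_inc m_dec; use F in \<open>auto simp: K_def incseq_def decseq_def; blast\<close>)+
    moreover have "(\<Union>i. E \<inter> F i) = E \<inter> (\<Union>i. F i)" "(\<Inter>i. E - F i) = E - (\<Union>i. F i)"
      "(\<Union>i. F i - E) = (\<Union>i. F i) - E" by auto
    ultimately show "(\<Union>i. F i) \<in> K E" by (simp add: K_def)
  next
    fix F :: "nat \<Rightarrow> 'a set" assume F: "range F \<subseteq> K E" "decseq F"
    have "(\<Inter>i. E \<inter> F i) \<in> m" "(\<Union>i. E - F i) \<in> m" "(\<Inter>i. F i - E) \<in> m"
      by (intro m_inc m_dec; use F in \<open>auto simp: K_def incseq_def decseq_def; blast\<close>)+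
    moreover have "(\<Inter>i. E \<inter> F i) = E \<inter> (\<Inter>i. F i)" "(\<Union>i. E - F i) = E - (\<Inter>i. F i)"
      "(\<Inter>i. F i - E) = (\<Inter>i. F i) - E" by auto
    ultimately show "(\<Inter>i. F i) \<in> K E" by (simp add: K_def)
  qed
  have K1: "m \<subseteq> K E" if "E \<in> A" for E
    by (intro m_least mono_K) (use that Am in \<open>auto simp: K_def\<close>)
  have K2: "m \<subseteq> K E" if "E \<in> m" for E
    by (intro m_least mono_K) (use that K1 in \<open>auto simp: K_def Int_commute\<close>)
  have compl: "\<Omega> - E \<in> m" if "E \<in> m" for E
    using K2[OF that] Am top by (auto simp: K_def)
  have m_sub: "E \<subseteq> \<Omega>" if "E \<in> m" for E
  proof -
    have "mono_class (Pow \<Omega>)" by (auto simp: mono_class_def)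
    then show ?thesis using m_least[of "Pow \<Omega>"] space_closed that by blast
  qed
  have un: "E \<union> F \<in> m" if "E \<in> m" "F \<in> m" for E F
  proof -
    have "(\<Omega> - E) \<inter> (\<Omega> - F) \<in> m" using K2 compl that by (auto simp: K_def)
    from compl[OF this] show ?thesis using m_sub that
      by (metis Diff_Un Diff_Diff_Int Int_absorb1 Un_least)
  qed
  have "E \<in> m" if "E \<in> sigma_sets \<Omega> A" for E
    using that
  proof induction
    case (Union F)
    have "(\<Union>i\<le>k. F i) \<in> m" for k
      by (induction k) (use Union un in \<open>auto simp: atMost_Suc\<close>)
    then have "(\<Union>k. \<Union>i\<le>k. F i) \<in> m"
      by (intro m_inc) (auto simp: incseq_def intro: order_trans)
    moreover have "(\<Union>k. \<Union>i\<le>k. F i) = (\<Union>i. F i)" by auto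
    ultimately show ?case by simp
  qed (use Am compl empty_sets in auto)
  moreover have "m \<subseteq> C" by (intro m_least AC) (use inc dec in \<open>auto simp: mono_class_def\<close>)
  ultimately show ?thesis by blast
qed

section \<open>Gaussian densities under a change of mean\<close>

lemma normal_density_shift_ratio:
  assumes "\<sigma> > 0"
  shows "normal_density m \<sigma> x = normal_density m' \<sigma> x * exp (((x - m')\<^sup>2 - (x - m)\<^sup>2) / (2 * \<sigma>\<^sup>2))"
  using assms by (simp add: normal_density_def field_simps flip: exp_add)

text \<open>Completing the square: the density times the squared likelihood ratio is a multiple of
  the normal density with the reflected mean \<open>2 * m - m'\<close>. Integration leaves exp((m -
  m')^2 / sigma^2), the source of the exponent in the comparison of laws.\<close>

lemma normal_density_ratio_square:
  assumes "\<sigma> > 0"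
  shows "normal_density m' \<sigma> x * (exp (((x - m')\<^sup>2 - (x - m)\<^sup>2) / (2 * \<sigma>\<^sup>2)))\<^sup>2 =
    exp ((m - m')\<^sup>2 / \<sigma>\<^sup>2) * normal_density (2 * m - m') \<sigma> x"
proof -
  have "- (x - m')\<^sup>2 / (2 * \<sigma>\<^sup>2) + 2 * (((x - m')\<^sup>2 - (x - m)\<^sup>2) / (2 * \<sigma>\<^sup>2)) =
     (m - m')\<^sup>2 / \<sigma>\<^sup>2 + - (x - (2 * m - m'))\<^sup>2 / (2 * \<sigma>\<^sup>2)"
    using assms by (simp add: divide_simps) (simp add: power2_eq_square algebra_simps)
  then show ?thesis
    by (simp add: normal_density_def mult_ac flip: exp_add exp_double)
qed

lemma nn_integral_normal_density: "\<sigma> > 0 \<Longrightarrow> (\<integral>\<^sup>+x. ennreal (normal_density m \<sigma> x) \<partial>lborel) = 1"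
  using prob_space.emeasure_space_1[OF prob_space_normal_density, of \<sigma> m]
  by (simp add: emeasure_density)

lemma nn_integral_normal_exp:
  assumes "\<sigma> > 0"
  shows "(\<integral>\<^sup>+x. ennreal (normal_density 0 \<sigma> x) * ennreal (exp (s * x)) \<partial>lborel) = ennreal (exp (s\<^sup>2 * \<sigma>\<^sup>2 / 2))"
proof -
  \<comment> \<open>Exponential tilting of a centred normal density shifts its mean to
    \<open>s * \<sigma>\<^sup>2\<close>.\<close>
  have *: "normal_density 0 \<sigma> x * exp (s * x) = exp (s\<^sup>2 * \<sigma>\<^sup>2 / 2) * normal_density (s * \<sigma>\<^sup>2) \<sigma> x" for x
  proof -
    have "- x\<^sup>2 / (2 * \<sigma>\<^sup>2) + s * x = s\<^sup>2 * \<sigma>\<^sup>2 / 2 + - (x - s * \<sigma>\<^sup>2)\<^sup>2 / (2 * \<sigma>\<^sup>2)"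
      using assms by (simp add: divide_simps) (simp add: power2_eq_square power4_eq_xxxx algebra_simps)
    then show ?thesis by (simp add: normal_density_def mult_ac flip: exp_add)
  qed
  have "(\<integral>\<^sup>+x. ennreal (normal_density 0 \<sigma> x) * ennreal (exp (s * x)) \<partial>lborel) =
     (\<integral>\<^sup>+x. ennreal (exp (s\<^sup>2 * \<sigma>\<^sup>2 / 2)) * ennreal (normal_density (s * \<sigma>\<^sup>2) \<sigma> x) \<partial>lborel)"
    by (simp add: * flip: ennreal_mult)
  then show ?thesis using assms by (simp add: nn_integral_cmult nn_integral_normal_density)
qed

text \<open>Cauchy-Schwarz for the likelihood ratio R: the mass of \<open>A\<close> under the means
  \<open>a\<close> is the integral of R over \<open>A\<close> under the means \<open>b\<close>, so
  its square is at most the second moment of R times the mass of \<open>A\<close> under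
  \<open>b\<close>. Independence makes this second moment a product over \<open>I\<close>.\<close>

lemma PiM_normal_shift_le:
  fixes a b \<sigma> :: "'i \<Rightarrow> real" and N :: "('i \<Rightarrow> real) \<Rightarrow> 'i \<Rightarrow> real measure"
  assumes I: "finite I" and \<sigma>: "\<And>i. i \<in> I \<Longrightarrow> \<sigma> i > 0"
    and A[measurable]: "A \<in> sets (PiM I (\<lambda>_. borel :: real measure))"
  defines "N c i \<equiv> density lborel (\<lambda>x. ennreal (normal_density (c i) (\<sigma> i) x))"
  shows "(emeasure (PiM I (N a)) A)\<^sup>2 \<le>
    ennreal (exp (\<Sum>i\<in>I. (a i - b i)\<^sup>2 / (\<sigma> i)\<^sup>2)) * emeasure (PiM I (N b)) A"
proof -
  define r where "r i x = ennreal (exp (((x - b i)\<^sup>2 - (x - a i)\<^sup>2) / (2 * (\<sigma> i)\<^sup>2)))" for i and x :: real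
  \<comment> \<open>A \<open>product_prob_space\<close> asks for a probability measure at every
    index, so the indices outside \<open>I\<close> receive a point mass; the product over
    \<open>I\<close> is unchanged (\<open>PiM_N\<close>).\<close>
  define N' where "N' c i = (if i \<in> I then N c i else return borel 0)" for c i
  have sets_N'[simp, measurable_cong]: "sets (N' c i) = sets borel" for c i by (simp add: N'_def N_def)
  have prob: "product_prob_space (N' c)" for c
  proof (rule product_prob_spaceI)
    show "prob_space (N' c i)" for i
      by (cases "i \<in> I") (simp_all add: N'_def N_def \<sigma> prob_space_normal_density prob_space_return)
  qed
  interpret a: product_prob_space "N' a" UNIV by (rule prob)
  interpret b: product_prob_space "N' b" UNIV by (rule prob)
  have PiM_N: "PiM I (N c) = PiM I (N' c)" for c by (rule PiM_cong) (auto simp: N'_def)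
  have r[measurable]: "r i \<in> borel_measurable borel" for i unfolding r_def[abs_def] by measurable
  have N_r: "density (N' b i) (r i) = N' a i" if "i \<in> I" for i
    using that \<sigma>[OF that] normal_density_shift_ratio[OF \<sigma>[OF that], of "a i" _ "b i"]
    by (simp add: N'_def N_def density_density_eq r_def flip: ennreal_mult)
  have r2: "(\<integral>\<^sup>+x. (r i x)\<^sup>2 \<partial>N' b i) = ennreal (exp ((a i - b i)\<^sup>2 / (\<sigma> i)\<^sup>2))" if "i \<in> I" for i
  proof -
    have "(\<integral>\<^sup>+x. (r i x)\<^sup>2 \<partial>N' b i) = (\<integral>\<^sup>+x. ennreal (normal_density (b i) (\<sigma> i) x) * (r i x)\<^sup>2 \<partial>lborel)"
      using that by (simp add: N'_def N_def nn_integral_density)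
    also have "\<dots> = (\<integral>\<^sup>+x. ennreal (exp ((a i - b i)\<^sup>2 / (\<sigma> i)\<^sup>2)) *
        ennreal (normal_density (2 * a i - b i) (\<sigma> i) x) \<partial>lborel)"
      using normal_density_ratio_square[OF \<sigma>[OF that], of "b i" _ "a i"]
      by (simp add: r_def ennreal_power flip: ennreal_mult)
    finally show ?thesis using \<sigma>[OF that] by (simp add: nn_integral_cmult nn_integral_normal_density)
  qed
  have sets_P: "sets (PiM I (N' c)) = sets (PiM I (\<lambda>_. borel))" for c
    by (rule sets_PiM_cong) auto
  note [measurable_cong] = sets_P
  define R where "R x = (\<Prod>i\<in>I. r i (x i))" for x
  have [measurable]: "R \<in> borel_measurable (PiM I (\<lambda>_. borel))"
    unfolding R_def by measurable
  \<comment> \<open>It suffices to compare the two measures on boxes, where both sides factor over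
    \<open>I\<close>.\<close>
  have "density (PiM I (N' b)) R = PiM I (N' a)"
  proof (rule a.PiM_eqI[OF I])
    fix B assume B: "\<And>i. i \<in> I \<Longrightarrow> B i \<in> sets (N' a i)"
    have "emeasure (density (PiM I (N' b)) R) (Pi\<^sub>E I B) =
      (\<integral>\<^sup>+x. R x * indicator (Pi\<^sub>E I B) x \<partial>PiM I (N' b))"
      using B I by (intro emeasure_density) (auto simp: sets_P intro!: sets_PiM_I_finite)
    also have "\<dots> = (\<integral>\<^sup>+x. (\<Prod>i\<in>I. r i (x i) * indicator (B i) (x i)) \<partial>PiM I (N' b))"
    proof (rule nn_integral_cong)
      fix x assume "x \<in> space (PiM I (N' b))"
      then have "indicator (Pi\<^sub>E I B) x = (\<Prod>i\<in>I. indicator (B i) (x i) :: ennreal)"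
        using I by (auto simp: indicator_def space_PiM PiE_iff)
      then show "R x * indicator (Pi\<^sub>E I B) x = (\<Prod>i\<in>I. r i (x i) * indicator (B i) (x i))"
        by (simp add: R_def prod.distrib)
    qed
    also have "\<dots> = (\<Prod>i\<in>I. \<integral>\<^sup>+x. r i x * indicator (B i) x \<partial>N' b i)"
      using B by (intro b.product_nn_integral_prod[OF I]) auto
    also have "\<dots> = (\<Prod>i\<in>I. emeasure (N' a i) (B i))"
      using B by (intro prod.cong refl) (simp add: emeasure_density flip: N_r)
    finally show "emeasure (density (PiM I (N' b)) R) (Pi\<^sub>E I B) = (\<Prod>i\<in>I. emeasure (N' a i) (B i))" .
  qed (simp add: sets_P)
  then have "(emeasure (PiM I (N' a)) A)\<^sup>2 = (\<integral>\<^sup>+x. R x * indicator A x \<partial>PiM I (N' b))\<^sup>2"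
    using A by (subst emeasure_density[symmetric]) (auto simp: sets_P)
  also have "\<dots> \<le> (\<integral>\<^sup>+x. (R x)\<^sup>2 \<partial>PiM I (N' b)) * (\<integral>\<^sup>+x. (indicator A x)\<^sup>2 \<partial>PiM I (N' b))"
    by (rule Cauchy_Schwarz_nn_integral) auto
  also have "(\<integral>\<^sup>+x. (R x)\<^sup>2 \<partial>PiM I (N' b)) = (\<Prod>i\<in>I. \<integral>\<^sup>+x. (r i x)\<^sup>2 \<partial>N' b i)"
    unfolding R_def prod_power_distrib by (intro b.product_nn_integral_prod[OF I]) auto
  also have "\<dots> = ennreal (exp (\<Sum>i\<in>I. (a i - b i)\<^sup>2 / (\<sigma> i)\<^sup>2))"
    using I by (simp add: r2 prod_ennreal exp_sum)
  also have "(\<integral>\<^sup>+x. (indicator A x)\<^sup>2 \<partial>PiM I (N' b)) = emeasure (PiM I (N' b)) A"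
  proof -
    have "(indicator A x)\<^sup>2 = (indicator A x :: ennreal)" for x :: "'i \<Rightarrow> real"
      by (simp add: indicator_def)
    then show ?thesis using A by (simp add: sets_P)
  qed
  finally show ?thesis by (simp add: PiM_N)
qed

section \<open>The space L2[0,1]\<close>

abbreviation leb01 :: "real measure" where "leb01 \<equiv> lebesgue_on {0..1}"

definition l2_inner :: "(real \<Rightarrow> real) \<Rightarrow> (real \<Rightarrow> real) \<Rightarrow> real" where
  "l2_inner f g = (\<integral>s. f s * g s \<partial>leb01)"

lemma prob_space_leb01: "prob_space leb01"
  by (rule prob_spaceI) (simp add: emeasure_restrict_space)

lemma L2_01_measurable[measurable_dest]: "f \<in> L2_01 \<Longrightarrow> f \<in> borel_measurable leb01"
  by (simp add: L2_01_def)

lemma L2_01_power2: "f \<in> L2_01 \<Longrightarrow> integrable leb01 (\<lambda>s. (f s)\<^sup>2)"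
  by (simp add: L2_01_def)

lemma integrable_L2_mult:
  assumes f[measurable]: "f \<in> L2_01" and g[measurable]: "g \<in> L2_01"
  shows "integrable leb01 (\<lambda>s. f s * g s)"
proof (rule Bochner_Integration.integrable_bound)
  show "integrable leb01 (\<lambda>s. (f s)\<^sup>2 + (g s)\<^sup>2)"
    using assms by (simp add: L2_01_power2)
  have "\<bar>x * y\<bar> \<le> x\<^sup>2 + y\<^sup>2" for x y :: real
    using sum_squares_bound[of "\<bar>x\<bar>" "\<bar>y\<bar>"] mult_nonneg_nonneg[of "\<bar>x\<bar>" "\<bar>y\<bar>"]
    unfolding abs_mult mult.assoc power2_abs by linarith
  then show "AE s in leb01. norm (f s * g s) \<le> norm ((f s)\<^sup>2 + (g s)\<^sup>2)"
    by auto
qed measurable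

lemma L2_01_bounded:
  assumes [measurable]: "f \<in> borel_measurable leb01" and "\<And>s. \<bar>f s\<bar> \<le> B"
  shows "f \<in> L2_01"
proof -
  interpret prob_space leb01 by (rule prob_space_leb01)
  have "(f s)\<^sup>2 \<le> B\<^sup>2" for s using power_mono[OF assms(2), of s 2] by simp
  then show ?thesis unfolding L2_01_def by (auto intro!: integrable_const_bound[where B = "B\<^sup>2"])
qed

lemma L2_01_const: "(\<lambda>_. c) \<in> L2_01"
  by (rule L2_01_bounded[where B = "\<bar>c\<bar>"]) auto

lemma integrable_L2: "f \<in> L2_01 \<Longrightarrow> integrable leb01 f"
  using integrable_L2_mult[OF _ L2_01_const[of 1]] by simp

lemma L2_01_add: "f \<in> L2_01 \<Longrightarrow> g \<in> L2_01 \<Longrightarrow> (\<lambda>s. f s + g s) \<in> L2_01"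
  using integrable_L2_mult[of f g]
  by (auto simp: L2_01_def power2_sum mult.assoc intro!: Bochner_Integration.integrable_add)

lemma L2_01_cmult: "f \<in> L2_01 \<Longrightarrow> (\<lambda>s. c * f s) \<in> L2_01"
  by (auto simp: L2_01_def power_mult_distrib)

lemma L2_01_diff: "f \<in> L2_01 \<Longrightarrow> g \<in> L2_01 \<Longrightarrow> (\<lambda>s. f s - g s) \<in> L2_01"
  using L2_01_add[of f "\<lambda>s. - 1 * g s"] L2_01_cmult[of g "-1"] by simp

lemma L2_01_sum: "(\<And>i. i \<in> I \<Longrightarrow> f i \<in> L2_01) \<Longrightarrow> (\<lambda>s. \<Sum>i\<in>I. f i s) \<in> L2_01"
  by (induction I rule: infinite_finite_induct) (simp_all add: L2_01_const L2_01_add)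

lemma L2_01_indicator_borel: "A \<in> sets borel \<Longrightarrow> indicator A \<in> L2_01"
  by (rule L2_01_bounded[where B = 1])
    (auto simp: indicator_def intro!: measurable_restrict_space1 measurable_completion)

lemma L2_01_indicator: "indicator {0..t} \<in> L2_01"
  by (rule L2_01_indicator_borel) simp

lemma l2_inner_commute: "l2_inner f g = l2_inner g f"
  by (simp add: l2_inner_def mult.commute)

lemma l2_inner_add: "f \<in> L2_01 \<Longrightarrow> g \<in> L2_01 \<Longrightarrow> h \<in> L2_01 \<Longrightarrow>
    l2_inner (\<lambda>s. f s + g s) h = l2_inner f h + l2_inner g h"
  by (simp add: l2_inner_def distrib_right integrable_L2_mult)

lemma l2_inner_add_right: "f \<in> L2_01 \<Longrightarrow> g \<in> L2_01 \<Longrightarrow> h \<in> L2_01 \<Longrightarrow>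
    l2_inner h (\<lambda>s. f s + g s) = l2_inner h f + l2_inner h g"
  by (simp add: l2_inner_def distrib_left integrable_L2_mult)

lemma l2_inner_diff: "f \<in> L2_01 \<Longrightarrow> g \<in> L2_01 \<Longrightarrow> h \<in> L2_01 \<Longrightarrow>
    l2_inner (\<lambda>s. f s - g s) h = l2_inner f h - l2_inner g h"
  by (simp add: l2_inner_def left_diff_distrib integrable_L2_mult)

lemma l2_inner_diff_right: "f \<in> L2_01 \<Longrightarrow> g \<in> L2_01 \<Longrightarrow> h \<in> L2_01 \<Longrightarrow>
    l2_inner h (\<lambda>s. f s - g s) = l2_inner h f - l2_inner h g"
  by (simp add: l2_inner_def right_diff_distrib integrable_L2_mult)

lemma l2_inner_cmult: "l2_inner (\<lambda>s. c * f s) g = c * l2_inner f g"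
  by (simp add: l2_inner_def mult.assoc)

lemma l2_norm_nonneg[simp]: "0 \<le> l2_norm f"
  by (simp add: l2_norm_def)

lemma l2_dist_nonneg[simp]: "0 \<le> l2_dist f g"
  by (simp add: l2_dist_def)

lemma l2_norm_power2: "(l2_norm f)\<^sup>2 = l2_inner f f"
  by (simp add: l2_norm_def l2_inner_def power2_eq_square)

text \<open>The quadratic |f - x g|^2 in x is nonnegative, so its discriminant is not positive. If
  its leading coefficient \<open>c\<close> is 0, it is affine and nonnegative everywhere, which
  forces \<open>b\<close> to vanish.\<close>

lemma l2_Cauchy_Schwarz:
  assumes f: "f \<in> L2_01" and g: "g \<in> L2_01"
  shows "\<bar>l2_inner f g\<bar> \<le> l2_norm f * l2_norm g"
proof -
  define a b c where "a = l2_inner f f" and "b = l2_inner f g" and "c = l2_inner g g"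
  have pos: "0 \<le> a - 2 * x * b + x\<^sup>2 * c" for x
  proof -
    have "0 \<le> l2_inner (\<lambda>s. f s - x * g s) (\<lambda>s. f s - x * g s)"
      by (simp flip: l2_norm_power2)
    also have "\<dots> = a - 2 * x * b + x\<^sup>2 * c"
      using f g by (simp add: a_def b_def c_def l2_inner_diff l2_inner_diff_right l2_inner_cmult
          L2_01_cmult L2_01_diff l2_inner_commute[of f "\<lambda>s. x * g s"] l2_inner_commute[of g "\<lambda>s. x * g s"]
          l2_inner_commute[of g f] power2_eq_square algebra_simps)
    finally show ?thesis .
  qed
  have "b\<^sup>2 \<le> a * c"
  proof (cases "c = 0")
    case True
    have "b = 0"
    proof (rule ccontr)
      assume "b \<noteq> 0"
      \<comment> \<open>At this x the affine function takes the value -1.\<close>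
      with pos[of "(a + 1) / (2 * b)"] True show False by (simp add: field_simps)
    qed
    with True show ?thesis by simp
  next
    case False
    have "0 \<le> c" by (simp add: c_def flip: l2_norm_power2)
    with False pos[of "b / c"] show ?thesis
      by (simp add: field_simps power2_eq_square)
  qed
  then have "\<bar>b\<bar>\<^sup>2 \<le> (l2_norm f * l2_norm g)\<^sup>2"
    by (simp add: a_def c_def power_mult_distrib l2_norm_power2)
  then show ?thesis unfolding b_def by (rule power2_le_imp_le) simp
qed

lemma l2_norm_add_le:
  assumes "f \<in> L2_01" "g \<in> L2_01"
  shows "l2_norm (\<lambda>s. f s + g s) \<le> l2_norm f + l2_norm g"
proof (rule power2_le_imp_le)
  have "(l2_norm (\<lambda>s. f s + g s))\<^sup>2 = (l2_norm f)\<^sup>2 + 2 * l2_inner f g + (l2_norm g)\<^sup>2"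
    using assms by (simp add: l2_norm_power2 l2_inner_add l2_inner_add_right L2_01_add l2_inner_commute[of g f])
  also have "\<dots> \<le> (l2_norm f + l2_norm g)\<^sup>2"
    using l2_Cauchy_Schwarz[OF assms] by (simp add: power2_sum)
  finally show "(l2_norm (\<lambda>s. f s + g s))\<^sup>2 \<le> (l2_norm f + l2_norm g)\<^sup>2" .
qed simp

lemma l2_norm_cmult: "l2_norm (\<lambda>s. c * f s) = \<bar>c\<bar> * l2_norm f"
  by (simp add: l2_norm_def power_mult_distrib real_sqrt_mult)

lemma l2_dist_commute: "l2_dist f g = l2_dist g f"
  by (simp add: l2_dist_def l2_norm_def power2_commute)

lemma l2_dist_triangle:
  assumes "f \<in> L2_01" "g \<in> L2_01" "h \<in> L2_01"
  shows "l2_dist f h \<le> l2_dist f g + l2_dist g h"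
  using l2_norm_add_le[OF L2_01_diff[OF assms(1,2)] L2_01_diff[OF assms(2,3)]]
  by (simp add: l2_dist_def)

section \<open>Density of the step functions in L2[0,1]\<close>

text \<open>In this form the integral of a step function against a path starting at 0 is
  the finite sum of \<open>b t * x t\<close>, and sums of step functions need no common partition.\<close>

definition step_fun :: "real set \<Rightarrow> (real \<Rightarrow> real) \<Rightarrow> real \<Rightarrow> real" where
  "step_fun J b s = (\<Sum>t\<in>J. b t * indicator {0..t} s)"

lemma step_fun_L2: "step_fun J b \<in> L2_01"
  unfolding step_fun_def[abs_def] by (intro L2_01_sum L2_01_cmult L2_01_indicator)

text \<open>Membership in the L2 closure of the step functions with knots in [0,1]. The closure is
  stable under linear combinations and dominated limits, so measure-theoretic induction shows that
  it is all of \<open>L2_01\<close>.\<close>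

definition step_approx :: "(real \<Rightarrow> real) \<Rightarrow> bool" where
  "step_approx g \<longleftrightarrow> g \<in> L2_01 \<and>
    (\<forall>e>0. \<exists>J b. finite J \<and> J \<subseteq> {0..1} \<and> l2_dist (step_fun J b) g < e)"

lemma step_fun_extend:
  assumes "finite J'" "J \<subseteq> J'"
  shows "step_fun J b = step_fun J' (\<lambda>t. if t \<in> J then b t else 0)"
  unfolding step_fun_def[abs_def] using assms
  by (intro ext sum.mono_neutral_cong_left) auto

lemma step_approx_add:
  assumes f: "step_approx f" and g: "step_approx g"
  shows "step_approx (\<lambda>s. f s + g s)"
  unfolding step_approx_def
proof (intro conjI allI impI)
  have L2: "f \<in> L2_01" "g \<in> L2_01" using f g by (auto simp: step_approx_def)
  then show "(\<lambda>s. f s + g s) \<in> L2_01" by (rule L2_01_add)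
  fix e :: real assume "e > 0"
  then have "e / 2 > 0" by simp
  with f g obtain J b J' b' where J: "finite J" "J \<subseteq> {0..1}" "l2_dist (step_fun J b) f < e / 2"
    and J': "finite J'" "J' \<subseteq> {0..1}" "l2_dist (step_fun J' b') g < e / 2"
    unfolding step_approx_def by meson
  \<comment> \<open>Both coefficient families are padded with 0, so that the two step functions
    share the union of their knots.\<close>
  define c where "c t = (if t \<in> J then b t else 0) + (if t \<in> J' then b' t else 0)" for t
  have *: "step_fun (J \<union> J') c s = step_fun J b s + step_fun J' b' s" for s
    using J(1) J'(1) by (subst step_fun_extend[of "J \<union> J'" J], simp, simp,
        subst step_fun_extend[of "J \<union> J'" J'], simp, simp)
      (simp add: step_fun_def c_def distrib_right sum.distrib)
  have "l2_dist (step_fun (J \<union> J') c) (\<lambda>s. f s + g s) =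
      l2_norm (\<lambda>s. (step_fun J b s - f s) + (step_fun J' b' s - g s))"
    by (simp add: l2_dist_def * algebra_simps)
  also have "\<dots> \<le> l2_dist (step_fun J b) f + l2_dist (step_fun J' b') g"
    unfolding l2_dist_def by (intro l2_norm_add_le L2_01_diff step_fun_L2 L2)
  also have "\<dots> < e" using J(3) J'(3) by simp
  finally show "\<exists>J b. finite J \<and> J \<subseteq> {0..1} \<and> l2_dist (step_fun J b) (\<lambda>s. f s + g s) < e"
    using J J' by (intro exI[of _ "J \<union> J'"] exI[of _ c]) auto
qed

lemma step_approx_cmult:
  assumes f: "step_approx f"
  shows "step_approx (\<lambda>s. c * f s)"
  unfolding step_approx_def
proof (intro conjI allI impI)
  have L2: "f \<in> L2_01" using f by (auto simp: step_approx_def)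
  then show "(\<lambda>s. c * f s) \<in> L2_01" by (rule L2_01_cmult)
  fix e :: real assume "e > 0"
  then have "e / (\<bar>c\<bar> + 1) > 0" by simp
  with f obtain J b where J: "finite J" "J \<subseteq> {0..1}" "l2_dist (step_fun J b) f < e / (\<bar>c\<bar> + 1)"
    unfolding step_approx_def by meson
  have "l2_dist (step_fun J (\<lambda>t. c * b t)) (\<lambda>s. c * f s) = l2_norm (\<lambda>s. c * (step_fun J b s - f s))"
    by (simp add: l2_dist_def step_fun_def sum_distrib_left algebra_simps)
  also have "\<dots> = \<bar>c\<bar> * l2_dist (step_fun J b) f"
    by (simp add: l2_norm_cmult l2_dist_def)
  also have "\<dots> \<le> (\<bar>c\<bar> + 1) * l2_dist (step_fun J b) f" by (simp add: mult_right_mono)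
  also have "\<dots> < e" using J(3) by (simp add: field_simps)
  finally show "\<exists>J b. finite J \<and> J \<subseteq> {0..1} \<and> l2_dist (step_fun J b) (\<lambda>s. c * f s) < e"
    using J by blast
qed

lemma step_approx_lim:
  assumes f: "\<And>n::nat. step_approx (f n)" and g: "g \<in> L2_01"
    and lim: "(\<lambda>n. l2_dist (f n) g) \<longlonglongrightarrow> 0"
  shows "step_approx g"
  unfolding step_approx_def
proof (intro conjI allI impI g)
  fix e :: real assume "e > 0"
  then have e: "e / 2 > 0" by simp
  from order_tendstoD(2)[OF lim this] obtain n where n: "l2_dist (f n) g < e / 2"
    by (auto dest: eventually_happens'[rotated])
  from f[of n] e obtain J b where J: "finite J" "J \<subseteq> {0..1}" "l2_dist (step_fun J b) (f n) < e / 2"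
    and L2: "f n \<in> L2_01"
    unfolding step_approx_def by meson
  have "l2_dist (step_fun J b) g \<le> l2_dist (step_fun J b) (f n) + l2_dist (f n) g"
    by (intro l2_dist_triangle step_fun_L2 L2 g)
  then show "\<exists>J b. finite J \<and> J \<subseteq> {0..1} \<and> l2_dist (step_fun J b) g < e"
    using J n by (intro exI[of _ J] exI[of _ b]) auto
qed

text \<open>The constant sequence \<open>f\<close> converges to \<open>g\<close>, as their distance
  is 0. This permits passing from a Borel version back to a function that is only Lebesgue
  measurable.\<close>

lemma step_approx_AE_cong:
  assumes f: "step_approx f" and g: "g \<in> L2_01" and eq: "AE s in leb01. f s = g s"
  shows "step_approx g"
proof (rule step_approx_lim[of "\<lambda>_. f"])
  have L2: "f \<in> L2_01" using f by (auto simp: step_approx_def)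
  have [measurable]: "f \<in> borel_measurable leb01" "g \<in> borel_measurable leb01"
    using L2 g by (auto simp: L2_01_def)
  have "(\<integral>s. (f s - g s)\<^sup>2 \<partial>leb01) = (\<integral>s. 0 \<partial>leb01)"
    by (rule integral_cong_AE) (use eq in auto)
  then show "(\<lambda>n. l2_dist f g) \<longlonglongrightarrow> 0" by (simp add: l2_dist_def l2_norm_def)
qed (use f g in auto)

text \<open>The differences are dominated by a square-integrable function, so their squares have an
  integrable majorant and dominated convergence gives convergence in L2.\<close>

lemma step_approx_dominated:
  assumes f: "\<And>n::nat. step_approx (f n)" and g: "g \<in> L2_01" and w: "w \<in> L2_01"
    and lim: "\<And>s. s \<in> {0..1} \<Longrightarrow> (\<lambda>n. f n s) \<longlonglongrightarrow> g s"
    and bound: "\<And>n s. s \<in> {0..1} \<Longrightarrow> \<bar>f n s - g s\<bar> \<le> \<bar>w s\<bar>"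
  shows "step_approx g"
proof (rule step_approx_lim[OF f g])
  have [measurable]: "f n \<in> borel_measurable leb01" "g \<in> borel_measurable leb01" for n
    using f g by (auto simp: L2_01_def step_approx_def)
  have "(\<lambda>n. \<integral>s. (f n s - g s)\<^sup>2 \<partial>leb01) \<longlonglongrightarrow> (\<integral>s. 0 \<partial>leb01)"
  proof (rule integral_dominated_convergence)
    show "integrable leb01 (\<lambda>s. (w s)\<^sup>2)" using w by (rule L2_01_power2)
    show "AE s in leb01. (\<lambda>n. (f n s - g s)\<^sup>2) \<longlonglongrightarrow> 0"
    proof (rule AE_I2)
      fix s assume "s \<in> space leb01"
      then have "(\<lambda>n. (f n s - g s)\<^sup>2) \<longlonglongrightarrow> (g s - g s)\<^sup>2" by (intro tendsto_intros lim) simp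
      then show "(\<lambda>n. (f n s - g s)\<^sup>2) \<longlonglongrightarrow> 0" by simp
    qed
    show "AE s in leb01. norm ((f n s - g s)\<^sup>2) \<le> (w s)\<^sup>2" for n
      using bound[of _ n] by (intro AE_I2) (auto simp: abs_le_square_iff)
  qed measurable
  then have "(\<lambda>n. sqrt (\<integral>s. (f n s - g s)\<^sup>2 \<partial>leb01)) \<longlonglongrightarrow> sqrt 0"
    by (intro tendsto_real_sqrt) simp
  then show "(\<lambda>n. l2_dist (f n) g) \<longlonglongrightarrow> 0"
    by (simp add: l2_dist_def l2_norm_def)
qed

lemma step_approx_step_fun: "finite J \<Longrightarrow> J \<subseteq> {0..1} \<Longrightarrow> step_approx (step_fun J b)"
  unfolding step_approx_def
  by (intro conjI allI impI step_fun_L2 exI[of _ J] exI[of _ b]) (auto simp: l2_dist_def l2_norm_def)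

lemma step_approx_cong:
  assumes "step_approx f" "\<And>s. s \<in> {0..1} \<Longrightarrow> f s = g s"
  shows "step_approx g"
proof (rule step_approx_AE_cong[OF assms(1)])
  show "AE s in leb01. f s = g s" using assms(2) by (intro AE_I2) auto
  have "g \<in> borel_measurable leb01 \<longleftrightarrow> f \<in> borel_measurable leb01"
    by (rule measurable_cong) (use assms(2) in auto)
  moreover have "integrable leb01 (\<lambda>s. (g s)\<^sup>2) \<longleftrightarrow> integrable leb01 (\<lambda>s. (f s)\<^sup>2)"
    by (rule Bochner_Integration.integrable_cong) (use assms(2) in auto)
  ultimately show "g \<in> L2_01" using assms(1) by (auto simp: step_approx_def L2_01_def)
qed

lemma step_approx_sum:
  assumes "\<And>i. i \<in> I \<Longrightarrow> step_approx (f i)"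
  shows "step_approx (\<lambda>s. \<Sum>i\<in>I. f i s)"
proof -
  have 0: "step_approx (\<lambda>_. 0)"
    using step_approx_step_fun[of "{}"] by (simp add: step_fun_def[abs_def])
  show ?thesis using assms
    by (induction I rule: infinite_finite_induct) (simp_all add: 0 step_approx_add)
qed

text \<open>Dynkin induction from the half-lines \<open>{..a}\<close>. Within [0,1] such a half-line
  is empty or the interval from 0 to \<open>min a 1\<close>, hence its indicator is a step function.
  Disjoint unions are limits of finite ones.\<close>

lemma step_approx_indicator:
  assumes "A \<in> sets (borel :: real measure)"
  shows "step_approx (indicator A)"
proof -
  let ?G = "range (\<lambda>a::real. {..a})"
  have borel: "sets borel = sigma_sets UNIV ?G"
    by (subst borel_eq_atMost) simp
  have "Int_stable ?G"
    by (auto simp: Int_stable_def)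
  moreover have "?G \<subseteq> Pow UNIV" by simp
  moreover have "A \<in> sigma_sets UNIV ?G" using assms borel by simp
  ultimately show ?thesis
  proof (induction rule: sigma_sets_induct_disjoint)
    case (basic B)
    then obtain a where B: "B = {..a}" by auto
    show ?case
    proof (cases "a < 0")
      case True
      show ?thesis
        by (rule step_approx_cong[OF step_approx_step_fun[of "{}"]])
          (use True B in \<open>auto simp: step_fun_def indicator_def\<close>)
    next
      case False
      show ?thesis
        by (rule step_approx_cong[OF step_approx_step_fun[of "{min a 1}" "\<lambda>_. 1"]])
          (use False B in \<open>auto simp: step_fun_def indicator_def\<close>)
    qed
  next
    case empty
    show ?case using step_approx_sum[of "{}"] by (simp add: indicator_def[abs_def])
  next
    case (compl B)
    \<comment> \<open>On [0,1] the function \<open>step_fun {1} (\<lambda>_. 1)\<close> is the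
      constant 1.\<close>
    have "step_approx (\<lambda>s. step_fun {1} (\<lambda>_. 1) s + (-1) * indicator B s)"
      using compl by (intro step_approx_add step_approx_cmult step_approx_step_fun) auto
    then show ?case
      by (rule step_approx_cong) (auto simp: step_fun_def indicator_def)
  next
    case (union F)
    have UN: "(\<Union>i. F i) \<in> sets borel" using union(2) borel by (auto intro!: sets.countable_UN)
    show ?case
    proof (rule step_approx_dominated)
      fix n :: nat
      have "step_approx (\<lambda>s. \<Sum>i<n. indicator (F i) s)"
        by (intro step_approx_sum union)
      moreover have "disjoint_family_on F {..<n}"
        using union(1) by (auto simp: disjoint_family_on_def)
      then have "indicator (\<Union>i<n. F i) = (\<lambda>s. \<Sum>i<n. indicator (F i) s :: real)"
        by (intro ext indicator_UN_disjoint) simp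
      ultimately show "step_approx (indicator (\<Union>i<n. F i))" by simp
    next
      show "(\<lambda>n. indicator (\<Union>i<n. F i) s :: real) \<longlonglongrightarrow> indicator (\<Union>i. F i) s" for s
        by (rule LIMSEQ_indicator_UN)
      show "\<bar>indicator (\<Union>i<n. F i) s - indicator (\<Union>i. F i) s\<bar> \<le> \<bar>1 :: real\<bar>" for n s
        by (simp add: indicator_def)
    qed (use UN in \<open>simp_all add: L2_01_indicator_borel L2_01_const\<close>)
  qed
qed

text \<open>Replace \<open>g\<close> by a Borel version, approximate that by simple functions, and
  use linearity to reduce to indicators of Borel sets.\<close>

lemma step_approx_L2:
  assumes "g \<in> L2_01"
  shows "step_approx g"
proof -
  have "(\<lambda>s. indicator {0..1} s *\<^sub>R g s) \<in> borel_measurable lebesgue"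
    using assms by (subst borel_measurable_restrict_space_iff[symmetric]) (auto simp: L2_01_def)
  from completion_ex_borel_measurable_real[OF this] obtain g' :: "real \<Rightarrow> real"
    where [measurable]: "g' \<in> borel_measurable borel"
      and AE_lborel: "AE s in lborel. indicator {0..1} s *\<^sub>R g s = g' s"
    by auto
  have AE_eq: "AE s in leb01. g' s = g s"
    using AE_completion[OF AE_lborel] by (auto simp: AE_restrict_space_iff)
  have g'[measurable]: "g' \<in> borel_measurable leb01"
    by (auto intro!: measurable_restrict_space1 measurable_completion)
  have [measurable]: "g \<in> borel_measurable leb01" using assms by (simp add: L2_01_def)
  have "integrable leb01 (\<lambda>s. (g' s)\<^sup>2) \<longleftrightarrow> integrable leb01 (\<lambda>s. (g s)\<^sup>2)"
    by (rule integrable_cong_AE) (use AE_eq in auto)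
  with assms g' have g'L2: "g' \<in> L2_01" by (auto simp: L2_01_def)
  \<comment> \<open>With base point 0 the simple functions satisfy |S i| <= 2 |g'|, so the
    differences S i - g' are dominated by 3 |g'|.\<close>
  from borel_measurable_implies_sequence_metric[of g' borel 0] obtain S where
    S: "\<And>i. simple_function borel (S i)" "\<And>s. (\<lambda>i. S i s) \<longlonglongrightarrow> g' s"
       "\<And>i s. \<bar>S i s\<bar> \<le> 2 * \<bar>g' s\<bar>"
    by (auto simp: dist_real_def)
  have SA: "step_approx (S i)" for i
  proof -
    have "finite (range (S i))" using simple_functionD(1)[OF S(1)] by simp
    then have eq: "S i = (\<lambda>s. \<Sum>y\<in>range (S i). y * indicator (S i -` {y}) s)"
      by (intro ext) (simp add: indicator_def if_distrib[where f = "\<lambda>x. _ * x"] sum.delta cong: if_cong)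
    show ?thesis
      using simple_functionD(2)[OF S(1)]
      by (subst eq, intro step_approx_sum step_approx_cmult step_approx_indicator) auto
  qed
  have "step_approx g'"
  proof (rule step_approx_dominated[OF SA g'L2 L2_01_cmult[OF g'L2, of 3] S(2)])
    show "\<bar>S i s - g' s\<bar> \<le> \<bar>3 * g' s\<bar>" for i s using S(3)[of i s] by simp
  qed
  then show ?thesis using assms AE_eq by (rule step_approx_AE_cong)
qed

section \<open>The white noise model\<close>

text \<open>The drift of the observed path, written as an inner product so that linearity and
  Cauchy-Schwarz apply to it.\<close>

definition primitive :: "(real \<Rightarrow> real) \<Rightarrow> real \<Rightarrow> real" where
  "primitive \<theta> t = l2_inner (indicator {0..t}) \<theta>"

lemma primitive_eq:
  assumes "t \<in> {0..1}"
  shows "(\<integral>s. \<theta> s \<partial>lebesgue_on {0..t}) = primitive \<theta> t"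
proof -
  have "(\<integral>s. \<theta> s \<partial>lebesgue_on {0..t}) = (\<integral>s. indicator {0..t} s *\<^sub>R \<theta> s \<partial>lebesgue)"
    by (rule integral_restrict_space) simp
  also have "\<dots> = (\<integral>s. indicator {0..1} s *\<^sub>R (indicator {0..t} s * \<theta> s) \<partial>lebesgue)"
    using assms by (intro Bochner_Integration.integral_cong) (auto simp: indicator_def)
  also have "\<dots> = primitive \<theta> t"
    unfolding primitive_def l2_inner_def by (rule integral_restrict_space[symmetric]) simp
  finally show ?thesis .
qed

lemma primitive_zero[simp]: "primitive \<theta> 0 = 0"
proof -
  have "(\<integral>s. \<theta> s \<partial>lebesgue_on {0..0}) = 0"
    by (subst integral_restrict_space)
      (auto simp: indicator_def intro!: integral_eq_zero_AE AE_completion AE_lborel_singleton[THEN eventually_mono])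
  then show ?thesis using primitive_eq[of 0 \<theta>] by simp
qed

lemma integral_interval_leb01:
  assumes "0 \<le> s" "s \<le> t" "t \<le> 1"
  shows "(\<integral>u. indicator {s<..t} u \<partial>leb01) = t - s"
proof -
  have "(\<integral>u. indicat_real {s<..t} u \<partial>leb01) = (\<integral>u. indicator {s<..t} u \<partial>lebesgue)"
  proof (subst integral_restrict_space)
    have "indicator {0..1} u *\<^sub>R indicat_real {s<..t} u = indicator {s<..t} u" for u
      using assms by (auto simp: indicator_def)
    then show "(\<integral>u. indicator {0..1} u *\<^sub>R indicat_real {s<..t} u \<partial>lebesgue) = (\<integral>u. indicator {s<..t} u \<partial>lebesgue)"
      by presburger
  qed simp
  then show ?thesis using assms by simp
qed

lemma primitive_diff:
  assumes "0 \<le> s" "s \<le> t" "\<theta> \<in> L2_01"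
  shows "primitive \<theta> t - primitive \<theta> s = l2_inner (indicator {s<..t}) \<theta>"
proof -
  have "primitive \<theta> t - primitive \<theta> s = l2_inner (\<lambda>u. indicator {0..t} u - indicator {0..s} u) \<theta>"
    using assms by (simp add: primitive_def l2_inner_diff L2_01_indicator)
  also have "(\<lambda>u. indicator {0..t} u - indicator {0..s} u :: real) = indicator {s<..t}"
    using assms by (auto simp: indicator_def fun_eq_iff)
  finally show ?thesis .
qed

lemma L2_01_indicator_mult:
  assumes "A \<in> sets borel" and f: "f \<in> L2_01"
  shows "(\<lambda>u. indicator A u * f u) \<in> L2_01"
proof -
  have [measurable]: "indicat_real A \<in> borel_measurable leb01" "f \<in> borel_measurable leb01"
    using L2_01_indicator_borel[OF assms(1)] f by (simp_all add: L2_01_def)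
  have "integrable leb01 (\<lambda>u. (indicator A u * f u)\<^sup>2)"
  proof (rule Bochner_Integration.integrable_bound[OF L2_01_power2[OF f]])
    show "AE u in leb01. norm ((indicator A u * f u)\<^sup>2) \<le> norm ((f u)\<^sup>2)"
      by (auto simp: indicator_def)
  qed measurable
  then show ?thesis by (simp add: L2_01_def)
qed

text \<open>The indicator is kept in both factors of Cauchy-Schwarz, so only the integral of the
  square of \<theta> over the interval enters. Over a partition these integrals add up to one
  squared norm, however fine the partition is.\<close>

lemma primitive_diff_power2_le:
  assumes st: "0 \<le> s" "s \<le> t" "t \<le> 1" and \<theta>: "\<theta> \<in> L2_01"
  shows "(primitive \<theta> t - primitive \<theta> s)\<^sup>2 \<le> (t - s) * (\<integral>u. indicator {s<..t} u * (\<theta> u)\<^sup>2 \<partial>leb01)"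
proof -
  have ind: "indicator {s<..t} \<in> L2_01" by (rule L2_01_indicator_borel) simp
  have L2: "(\<lambda>u. indicator {s<..t} u * \<theta> u) \<in> L2_01"
    by (rule L2_01_indicator_mult[OF _ \<theta>]) simp
  have "primitive \<theta> t - primitive \<theta> s = l2_inner (indicator {s<..t}) (\<lambda>u. indicator {s<..t} u * \<theta> u)"
    unfolding primitive_diff[OF st(1,2) \<theta>] l2_inner_def
    by (intro Bochner_Integration.integral_cong) (auto simp: indicator_def)
  also have "\<bar>\<dots>\<bar> \<le> l2_norm (indicator {s<..t}) * l2_norm (\<lambda>u. indicator {s<..t} u * \<theta> u)"
    by (rule l2_Cauchy_Schwarz[OF ind L2])
  finally have "\<bar>primitive \<theta> t - primitive \<theta> s\<bar>\<^sup>2 \<le>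
      (l2_norm (indicator {s<..t}) * l2_norm (\<lambda>u. indicator {s<..t} u * \<theta> u))\<^sup>2"
    by (rule power_mono) simp
  then have "(primitive \<theta> t - primitive \<theta> s)\<^sup>2 \<le>
      (l2_norm (indicator {s<..t}))\<^sup>2 * (l2_norm (\<lambda>u. indicator {s<..t} u * \<theta> u))\<^sup>2"
    by (simp add: power_mult_distrib)
  also have "(l2_norm (indicator {s<..t}))\<^sup>2 = t - s"
    using integral_interval_leb01[OF st] unfolding l2_norm_power2 l2_inner_def
    by (simp flip: indicator_inter_arith)
  also have "(l2_norm (\<lambda>u. indicator {s<..t} u * \<theta> u))\<^sup>2 = (\<integral>u. indicator {s<..t} u * (\<theta> u)\<^sup>2 \<partial>leb01)"
    unfolding l2_norm_power2 l2_inner_def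
    by (intro Bochner_Integration.integral_cong) (auto simp: indicator_def power2_eq_square)
  finally show ?thesis .
qed

text \<open>Increments of the primitive are at most the norm of \<theta> times the square root of
  the length of the interval. The \<open>+ 1\<close> in \<open>B\<close> keeps the modulus of
  continuity meaningful when the norm is 0.\<close>

lemma continuous_on_primitive:
  assumes \<theta>: "\<theta> \<in> L2_01"
  shows "continuous_on {0..1} (primitive \<theta>)"
proof (rule uniformly_continuous_imp_continuous, unfold uniformly_continuous_on_def, intro allI impI)
  fix e :: real assume "e > 0"
  define B where "B = (l2_norm \<theta>)\<^sup>2 + 1"
  have B: "B > 0" by (simp add: B_def add_nonneg_pos)
  have *: "\<bar>primitive \<theta> t - primitive \<theta> s\<bar> < e" if "0 \<le> s" "s \<le> t" "t \<le> 1" "t - s < e\<^sup>2 / B" for s t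
  proof -
    have "(\<integral>u. indicator {s<..t} u * (\<theta> u)\<^sup>2 \<partial>leb01) \<le> (\<integral>u. (\<theta> u)\<^sup>2 \<partial>leb01)"
      by (rule integral_mono') (auto simp: L2_01_power2[OF \<theta>] indicator_def)
    also have "\<dots> \<le> B" unfolding B_def l2_norm_power2 l2_inner_def by (simp add: power2_eq_square)
    finally have "(primitive \<theta> t - primitive \<theta> s)\<^sup>2 \<le> (t - s) * B"
      using primitive_diff_power2_le[OF that(1-3) \<theta>] that(2)
      by (meson diff_ge_0_iff_ge mult_left_mono order_trans)
    also have "\<dots> < e\<^sup>2" using that(4) B by (simp add: field_simps)
    finally have "\<bar>primitive \<theta> t - primitive \<theta> s\<bar>\<^sup>2 < e\<^sup>2" by simp
    then show ?thesis by (rule power2_less_imp_less) (rule less_imp_le[OF \<open>e > 0\<close>])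
  qed
  show "\<exists>d>0. \<forall>x\<in>{0..1}. \<forall>x'\<in>{0..1}. dist x' x < d \<longrightarrow> dist (primitive \<theta> x') (primitive \<theta> x) < e"
  proof (intro exI[of _ "e\<^sup>2 / B"] conjI ballI impI)
    fix x x' :: real assume "x \<in> {0..1}" "x' \<in> {0..1}" "dist x' x < e\<^sup>2 / B"
    then show "dist (primitive \<theta> x') (primitive \<theta> x) < e"
      using *[of x x'] *[of x' x] unfolding dist_real_def atLeastAtMost_iff by linarith
  qed (use \<open>e > 0\<close> B in auto)
qed

text \<open>The point 0 is adjoined because paths vanish there, which makes path values sums of
  increments; the point 1 is adjoined so that the intervals fill [0,1] and at least one increment
  exists.\<close>

lemma finite_set_enumeration:
  fixes J :: "real set"
  assumes "finite J" "J \<subseteq> {0..1}"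
  obtains k \<tau> where "k \<ge> (1::nat)" "strict_mono_on {..k} \<tau>" "\<tau> ` {..k} = insert 0 (insert 1 J)"
    "\<tau> 0 = 0" "\<tau> k = (1::real)"
proof -
  define K where "K = insert 0 (insert 1 J)"
  have K: "finite K" "K \<subseteq> {0..1}" "0 \<in> K" "1 \<in> K" using assms by (auto simp: K_def)
  define xs where "xs = sorted_list_of_set K"
  have set_xs: "set xs = K" and sorted: "sorted_wrt (<) xs"
    using K(1) by (auto simp: xs_def)
  have "card {0, 1::real} \<le> card K" using K by (intro card_mono) auto
  then have len: "length xs \<ge> 2" using K(1) by (simp add: xs_def)
  define k where "k = length xs - 1"
  define \<tau> where "\<tau> i = xs ! i" for i
  have mono: "\<tau> i < \<tau> j" if "i < j" "j \<le> k" for i j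
    using sorted_wrt_nth_less[OF sorted that(1)] that(2) len by (simp add: \<tau>_def k_def)
  have img: "\<tau> ` {..k} = K"
  proof -
    have "{..k} = {..<length xs}" using len by (auto simp: k_def)
    then show ?thesis using set_xs by (auto simp: \<tau>_def set_conv_nth)
  qed
  have mono': "\<tau> i \<le> \<tau> j" if "i \<le> j" "j \<le> k" for i j
    using mono[of i j] that by (cases "i = j") auto
  have "\<tau> 0 = 0"
  proof -
    obtain i where "i \<le> k" "\<tau> i = 0" using img K(3) by (metis atMost_iff imageE)
    with mono'[of 0 i] have "\<tau> 0 \<le> 0" by simp
    moreover have "\<tau> 0 \<in> {0..1}" using img K(2) by auto
    ultimately show ?thesis by simp
  qed
  moreover have "\<tau> k = 1"
  proof -
    obtain i where "i \<le> k" "\<tau> i = 1" using img K(4) by (metis atMost_iff imageE)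
    with mono'[of i k] have "\<tau> k \<ge> 1" by simp
    moreover have "\<tau> k \<in> {0..1}" using img K(2) by auto
    ultimately show ?thesis by simp
  qed
  moreover have "strict_mono_on {..k} \<tau>" by (auto simp: strict_mono_on_def mono)
  moreover have "k \<ge> 1" using len by (simp add: k_def)
  ultimately show ?thesis using that img by (simp add: K_def)
qed

context standard_brownian_motion
begin

lemma measurable_W'[measurable]: "t \<in> {0..1} \<Longrightarrow> W t \<in> borel_measurable M"
  by (rule measurable_W)

text \<open>With \<open>c\<close> equal to 1/sqrt n and \<open>a\<close> the increments of the
  drift, this is the joint law of the increments of the observed path.\<close>

lemma increments_distr:
  fixes k :: nat and \<tau> a :: "_ \<Rightarrow> real"
  assumes k: "k \<ge> 1" and \<tau>: "strict_mono_on {..k} \<tau>" "\<tau> ` {..k} \<subseteq> {0..1}" and c: "c > 0"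
  shows "distr M (PiM {..<k} (\<lambda>_. borel))
      (\<lambda>\<omega>. \<lambda>i\<in>{..<k}. a i + c * (W (\<tau> (Suc i)) \<omega> - W (\<tau> i) \<omega>)) =
    PiM {..<k} (\<lambda>i. density lborel (\<lambda>x. ennreal (normal_density (a i) (c * sqrt (\<tau> (Suc i) - \<tau> i)) x)))"
proof -
  let ?X = "\<lambda>i \<omega>. W (\<tau> (Suc i)) \<omega> - W (\<tau> i) \<omega>"
  have in01: "\<tau> i \<in> {0..1}" if "i \<le> k" for i using \<tau>(2) that by auto
  have less: "\<tau> i < \<tau> (Suc i)" if "i < k" for i
    using \<tau>(1) that by (auto simp: strict_mono_on_def)
  have meas: "?X i \<in> borel_measurable M" if "i < k" for i
    using in01[of i] in01[of "Suc i"] that by (intro borel_measurable_diff measurable_W) auto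
  have "0 \<in> {..<k}" using k by simp
  then have ne: "{..<k} \<noteq> {}" by blast
  have "indep_vars (\<lambda>_. borel) ?X {..<k}"
    using \<tau> by (intro independent_increments strict_mono_on_imp_mono_on)
  then have "indep_vars (\<lambda>_. borel) (\<lambda>i \<omega>. a i + c * ?X i \<omega>) {..<k}"
    by (rule indep_vars_compose2) auto
  then have "distr M (PiM {..<k} (\<lambda>_. borel)) (\<lambda>\<omega>. \<lambda>i\<in>{..<k}. a i + c * ?X i \<omega>) =
      PiM {..<k} (\<lambda>i. distr M borel (\<lambda>\<omega>. a i + c * ?X i \<omega>))"
    using k ne meas by (subst (asm) indep_vars_iff_distr_eq_PiM') auto
  also have "\<dots> = PiM {..<k} (\<lambda>i. density lborel
      (\<lambda>x. ennreal (normal_density (a i) (c * sqrt (\<tau> (Suc i) - \<tau> i)) x)))"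
  proof (rule PiM_cong[OF refl])
    fix i assume i: "i \<in> {..<k}"
    then have "distributed M lborel (?X i) (normal_density 0 (sqrt (\<tau> (Suc i) - \<tau> i)))"
      using less[of i] in01[of i] in01[of "Suc i"] by (intro gaussian_increments) auto
    from normal_density_affine[OF this, of c "a i"]
    have "distributed M lborel (\<lambda>\<omega>. a i + c * ?X i \<omega>) (normal_density (a i) (c * sqrt (\<tau> (Suc i) - \<tau> i)))"
      using less[of i] i c by simp
    from distributed_distr_eq_density[OF this]
    show "distr M borel (\<lambda>\<omega>. a i + c * ?X i \<omega>) =
       density lborel (\<lambda>x. ennreal (normal_density (a i) (c * sqrt (\<tau> (Suc i) - \<tau> i)) x))"
      by (simp cong: distr_cong)
  qed
  finally show ?thesis .
qed

lemma white_noise_path_eq: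
  "t \<in> {0..1} \<Longrightarrow> white_noise_path W n \<theta> \<omega> t = primitive \<theta> t + W t \<omega> / sqrt (real n)"
  by (simp add: white_noise_path_def primitive_eq)

lemma white_noise_path_measurable:
  assumes \<theta>: "\<theta> \<in> L2_01"
  shows "white_noise_path W n \<theta> \<in> measurable M C01"
  unfolding C01_def
proof (rule measurable_restrict_space2)
  have "(\<lambda>\<omega>. \<lambda>t\<in>{0..1}. primitive \<theta> t + W t \<omega> / sqrt (real n)) \<in> measurable M (PiM {0..1} (\<lambda>_. borel))"
    by (intro measurable_restrict) measurable
  also have "(\<lambda>\<omega>. \<lambda>t\<in>{0..1}. primitive \<theta> t + W t \<omega> / sqrt (real n)) = white_noise_path W n \<theta>"
    by (auto simp: fun_eq_iff white_noise_path_def primitive_eq)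
  finally show "white_noise_path W n \<theta> \<in> measurable M (PiM {0..1} (\<lambda>_. borel))" .
  show "white_noise_path W n \<theta> \<in> space M \<rightarrow> {x. continuous_on {0..1} x}"
  proof (intro Pi_I CollectI)
    fix \<omega> assume "\<omega> \<in> space M"
    then have "continuous_on {0..1} (\<lambda>t. primitive \<theta> t + W t \<omega> / sqrt (real n))"
      unfolding divide_inverse
      by (intro continuous_on_add continuous_on_mult_right continuous_on_primitive[OF \<theta>] continuous_paths)
    then show "continuous_on {0..1} (white_noise_path W n \<theta> \<omega>)"
      by (rule continuous_on_eq) (simp add: white_noise_path_eq)
  qed
qed

lemma prob_space_white_noise_law: "\<theta> \<in> L2_01 \<Longrightarrow> prob_space (white_noise_law M W n \<theta>)"
  unfolding white_noise_law_def by (intro prob_space_distr white_noise_path_measurable)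

end

section \<open>Comparison of white noise laws\<close>

text \<open>By strict monotonicity the condition on \<open>l\<close> means l < i. It is phrased
  through the time \<open>\<tau> i\<close> and not through its index, so that path values at given
  times can be written as sums of increments and sums over times and increments can be
  interchanged.\<close>

lemma enumeration_telescope:
  fixes \<tau> f :: "_ \<Rightarrow> real"
  assumes \<tau>: "strict_mono_on {..k::nat} \<tau>" and i: "i \<le> k"
  shows "(\<Sum>l | l < k \<and> \<tau> (Suc l) \<le> \<tau> i. f (\<tau> (Suc l)) - f (\<tau> l)) = f (\<tau> i) - f (\<tau> 0)"
proof -
  have less: "\<tau> l < \<tau> j" if "l < j" "j \<le> k" for l j
    using \<tau> that by (auto simp: strict_mono_on_def)
  have "{l. l < k \<and> \<tau> (Suc l) \<le> \<tau> i} = {..<i}"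
  proof (intro set_eqI iffI)
    fix l assume "l \<in> {l. l < k \<and> \<tau> (Suc l) \<le> \<tau> i}"
    then show "l \<in> {..<i}" using less[of i "Suc l"] by (cases "l < i") auto
  next
    fix l assume "l \<in> {..<i}"
    then show "l \<in> {l. l < k \<and> \<tau> (Suc l) \<le> \<tau> i}"
      using less[of "Suc l" i] i by (cases "Suc l = i") auto
  qed
  then show ?thesis by (simp add: sum_lessThan_telescope[of "\<lambda>j. f (\<tau> j)"])
qed

context standard_brownian_motion
begin

text \<open>The path at the times in \<open>J\<close> is a fixed linear image of independent normal
  increments. On each interval the squared difference of the drifts divided by the variance is at
  most n times the integral of (theta - eta)^2 over that interval. The resulting constant does not
  depend on \<open>J\<close>, which is what makes an extension to all events possible.\<close>

lemma white_noise_cylinder_le: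
  assumes n: "n \<ge> 1" and \<theta>: "\<theta> \<in> L2_01" and \<eta>: "\<eta> \<in> L2_01"
    and J: "finite J" "J \<subseteq> {0..1}" and A: "A \<in> sets (PiM J (\<lambda>_. borel))"
  defines "E \<equiv> \<lambda>\<phi>. {\<omega> \<in> space M. restrict (white_noise_path W n \<phi> \<omega>) J \<in> A}"
  shows "(emeasure M (E \<theta>))\<^sup>2 \<le> ennreal (exp (real n * (l2_dist \<theta> \<eta>)\<^sup>2)) * emeasure M (E \<eta>)"
proof -
  obtain k \<tau> where k: "k \<ge> (1::nat)" and \<tau>: "strict_mono_on {..k} \<tau>" "\<tau> ` {..k} = insert 0 (insert 1 J)"
    "\<tau> 0 = 0" "\<tau> k = (1::real)"
    by (rule finite_set_enumeration[OF J])
  have in01: "\<tau> i \<in> {0..1}" if "i \<le> k" for i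
  proof -
    have "\<tau> ` {..k} \<subseteq> {0..1}" using \<tau>(2) J(2) by simp
    then show ?thesis using that by blast
  qed
  have less: "\<tau> i < \<tau> j" if "i < j" "j \<le> k" for i j
    using \<tau>(1) that by (auto simp: strict_mono_on_def)
  define c where "c = 1 / sqrt (real n)"
  have c: "c > 0" "c\<^sup>2 = 1 / real n" using n by (simp_all add: c_def power_divide)
  define \<sigma> where "\<sigma> i = c * sqrt (\<tau> (Suc i) - \<tau> i)" for i
  have \<sigma>: "\<sigma> i > 0" if "i < k" for i using c less[of i "Suc i"] that by (simp add: \<sigma>_def)
  define a where "a \<theta> i = primitive \<theta> (\<tau> (Suc i)) - primitive \<theta> (\<tau> i)" for \<theta> i
  \<comment> \<open>Rebuilds the path values on \<open>J\<close> from the increments.\<close>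
  define \<Phi> where "\<Phi> y = (\<lambda>t\<in>J. \<Sum>l | l < k \<and> \<tau> (Suc l) \<le> t. y l)" for y :: "nat \<Rightarrow> real"
  define Y where "Y \<theta> \<omega> = (\<lambda>i\<in>{..<k}. a \<theta> i + c * (W (\<tau> (Suc i)) \<omega> - W (\<tau> i) \<omega>))" for \<theta> \<omega>
  have \<Phi>[measurable]: "\<Phi> \<in> measurable (PiM {..<k} (\<lambda>_. borel)) (PiM J (\<lambda>_. borel))"
    unfolding \<Phi>_def[abs_def] by (intro measurable_restrict borel_measurable_sum) auto
  have Y[measurable]: "Y \<theta> \<in> measurable M (PiM {..<k} (\<lambda>_. borel))" for \<theta>
    unfolding Y_def[abs_def] using in01
    by (intro measurable_restrict borel_measurable_add borel_measurable_times borel_measurable_diff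
        measurable_W borel_measurable_const) auto
  have path: "restrict (white_noise_path W n \<theta> \<omega>) J = \<Phi> (Y \<theta> \<omega>)" if \<omega>: "\<omega> \<in> space M" for \<theta> \<omega>
  proof
    fix t show "restrict (white_noise_path W n \<theta> \<omega>) J t = \<Phi> (Y \<theta> \<omega>) t"
    proof (cases "t \<in> J")
      case True
      then obtain i where i: "i \<le> k" "t = \<tau> i" using \<tau>(2) by (metis atMost_iff imageE insertCI)
      define f where "f t = primitive \<theta> t + c * W t \<omega>" for t
      have "\<Phi> (Y \<theta> \<omega>) t = (\<Sum>l | l < k \<and> \<tau> (Suc l) \<le> \<tau> i. f (\<tau> (Suc l)) - f (\<tau> l))"
        using True i(2) by (auto simp: \<Phi>_def Y_def a_def f_def algebra_simps intro!: sum.cong)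
      also have "\<dots> = f t - f 0"
        using enumeration_telescope[OF \<tau>(1) i(1), of f] i(2) \<tau>(3) by simp
      also have "f 0 = 0" using starts_at_0[OF \<omega>] by (simp add: f_def)
      also have "f t = white_noise_path W n \<theta> \<omega> t"
        using in01[OF i(1)] i(2) by (simp add: f_def c_def white_noise_path_eq)
      finally show ?thesis using True by simp
    qed (simp add: \<Phi>_def)
  qed
  define N where "N \<theta> = PiM {..<k} (\<lambda>i. density lborel (\<lambda>x. ennreal (normal_density (a \<theta> i) (\<sigma> i) x)))" for \<theta>
  define B where "B = \<Phi> -` A \<inter> space (PiM {..<k} (\<lambda>_. borel))"
  have B: "B \<in> sets (PiM {..<k} (\<lambda>_. borel))"
    unfolding B_def using \<Phi> A by (rule measurable_sets)
  have E: "emeasure M (E \<theta>) = emeasure (N \<theta>) B" for \<theta>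
  proof -
    have "N \<theta> = distr M (PiM {..<k} (\<lambda>_. borel)) (Y \<theta>)"
      unfolding N_def \<sigma>_def Y_def
      using in01 by (intro increments_distr[symmetric] k c(1) \<tau>(1)) auto
    then have "emeasure (N \<theta>) B = emeasure M (Y \<theta> -` B \<inter> space M)"
      using B Y by (simp add: emeasure_distr)
    also have "Y \<theta> -` B \<inter> space M = E \<theta>"
      using measurable_space[OF Y, of _ \<theta>] by (auto simp: B_def E_def path)
    finally show ?thesis by simp
  qed
  define g where "g s = \<theta> s - \<eta> s" for s
  have g: "g \<in> L2_01" unfolding g_def[abs_def] by (rule L2_01_diff[OF \<theta> \<eta>])
  have prim_g: "primitive g t = primitive \<theta> t - primitive \<eta> t" for t
    unfolding primitive_def g_def[abs_def] by (rule l2_inner_diff_right[OF \<theta> \<eta> L2_01_indicator])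
  \<comment> \<open>The integral of (theta - eta)^2 up to time t; the bounds for the intervals are
    differences of \<open>G\<close> and telescope.\<close>
  define G where "G t = (\<integral>u. indicator {0..t} u * (g u)\<^sup>2 \<partial>leb01)" for t :: real
  have int_G: "integrable leb01 (\<lambda>u. indicator S u * (g u)\<^sup>2)" if "S \<in> sets borel" for S
  proof -
    have "indicator S u * (g u)\<^sup>2 = (indicator S u * g u) * (indicator S u * g u)" for u
      by (simp add: indicator_def power2_eq_square)
    then show ?thesis
      using integrable_L2_mult[OF L2_01_indicator_mult[OF that g] L2_01_indicator_mult[OF that g]]
      by (simp only:)
  qed
  have indicator_interval_diff: "indicat_real {0..t} u - indicator {0..s} u = indicator {s<..t} u"
    if "0 \<le> s" "s < t" for s t u :: real
    using that by (auto simp: indicator_def)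
  have summand: "(a \<theta> i - a \<eta> i)\<^sup>2 / (\<sigma> i)\<^sup>2 \<le> real n * (G (\<tau> (Suc i)) - G (\<tau> i))" if i: "i < k" for i
  proof -
    have t: "0 \<le> \<tau> i" "\<tau> i < \<tau> (Suc i)" "\<tau> (Suc i) \<le> 1"
      using in01[of i] in01[of "Suc i"] less[of i "Suc i"] i by auto
    have "(a \<theta> i - a \<eta> i)\<^sup>2 = (primitive g (\<tau> (Suc i)) - primitive g (\<tau> i))\<^sup>2"
      by (simp add: a_def prim_g algebra_simps)
    also have "\<dots> \<le> (\<tau> (Suc i) - \<tau> i) * (\<integral>u. indicator {\<tau> i<..\<tau> (Suc i)} u * (g u)\<^sup>2 \<partial>leb01)"
      using t g by (intro primitive_diff_power2_le) auto
    also have "(\<integral>u. indicator {\<tau> i<..\<tau> (Suc i)} u * (g u)\<^sup>2 \<partial>leb01) = G (\<tau> (Suc i)) - G (\<tau> i)"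
      unfolding G_def using t
      by (subst Bochner_Integration.integral_diff[symmetric])
        (simp_all add: int_G left_diff_distrib[symmetric] indicator_interval_diff)
    finally have "(a \<theta> i - a \<eta> i)\<^sup>2 \<le> (\<tau> (Suc i) - \<tau> i) * (G (\<tau> (Suc i)) - G (\<tau> i))" .
    moreover have "(\<sigma> i)\<^sup>2 = (\<tau> (Suc i) - \<tau> i) / real n"
      using t by (simp add: \<sigma>_def power_mult_distrib c(2))
    moreover have "x / (d / r) \<le> r * e" if "x \<le> d * e" "d > 0" "r > 0" for x d e r :: real
      using that by (simp add: field_simps)
    ultimately show ?thesis using t n by simp
  qed
  have "(\<Sum>i<k. (a \<theta> i - a \<eta> i)\<^sup>2 / (\<sigma> i)\<^sup>2) \<le> (\<Sum>i<k. real n * (G (\<tau> (Suc i)) - G (\<tau> i)))"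
    by (intro sum_mono summand) simp
  also have "\<dots> = real n * (G 1 - G 0)"
    using sum_lessThan_telescope[of "\<lambda>i. G (\<tau> i)" k] by (simp add: \<tau> flip: sum_distrib_left)
  also have "\<dots> \<le> real n * (l2_dist \<theta> \<eta>)\<^sup>2"
  proof (intro mult_left_mono)
    have "G 0 \<ge> 0" unfolding G_def by (intro integral_nonneg_AE) auto
    moreover have "G 1 = l2_inner g g"
      unfolding G_def l2_inner_def by (intro Bochner_Integration.integral_cong) (auto simp: power2_eq_square)
    ultimately show "G 1 - G 0 \<le> (l2_dist \<theta> \<eta>)\<^sup>2"
      by (simp add: l2_dist_def l2_norm_power2 flip: g_def)
  qed simp
  finally have "exp (\<Sum>i<k. (a \<theta> i - a \<eta> i)\<^sup>2 / (\<sigma> i)\<^sup>2) \<le> exp (real n * (l2_dist \<theta> \<eta>)\<^sup>2)" by simp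
  moreover have "(emeasure (N \<theta>) B)\<^sup>2 \<le>
      ennreal (exp (\<Sum>i<k. (a \<theta> i - a \<eta> i)\<^sup>2 / (\<sigma> i)\<^sup>2)) * emeasure (N \<eta>) B"
    unfolding N_def using B by (intro PiM_normal_shift_le \<sigma>) auto
  ultimately show ?thesis
    unfolding E by (meson ennreal_leI mult_right_mono order_trans zero_le)
qed

lemma white_noise_law_shift_le:
  assumes n: "n \<ge> 1" and \<theta>: "\<theta> \<in> L2_01" and \<eta>: "\<eta> \<in> L2_01" and E: "E \<in> sets C01"
  shows "(emeasure (white_noise_law M W n \<theta>) E)\<^sup>2 \<le>
    ennreal (exp (real n * (l2_dist \<theta> \<eta>)\<^sup>2)) * emeasure (white_noise_law M W n \<eta>) E"
proof -
  let ?S = "PiM {0..1::real} (\<lambda>_. borel :: real measure)"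
  let ?K = "ennreal (exp (real n * (l2_dist \<theta> \<eta>)\<^sup>2))"
  define P where "P \<phi> = distr M ?S (white_noise_path W n \<phi>)" for \<phi>
  have path: "white_noise_path W n \<phi> \<in> measurable M ?S"
    "\<And>\<omega>. \<omega> \<in> space M \<Longrightarrow> continuous_on {0..1} (white_noise_path W n \<phi> \<omega>)" if "\<phi> \<in> L2_01" for \<phi>
    using white_noise_path_measurable[OF that, of n] unfolding C01_def
    by (auto simp: measurable_restrict_space2_iff)
  have restr: "(\<lambda>\<omega>. restrict (white_noise_path W n \<theta> \<omega>) J) \<in> measurable M (PiM J (\<lambda>_. borel))"
    if "J \<subseteq> {0..1}" for J
    using measurable_restrict_subset[OF that] path(1)[OF \<theta>]
    by (rule measurable_compose[rotated])
  \<comment> \<open>The finite-dimensional marginals. As a projective family they give access to the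
    cylinders as an algebra that generates the product sigma-algebra.\<close>
  define Q where "Q J = distr M (PiM J (\<lambda>_. borel :: real measure)) (\<lambda>\<omega>. restrict (white_noise_path W n \<theta> \<omega>) J)" for J
  have pf: "projective_family {0..1} Q (\<lambda>_. borel)"
  proof (rule projective_family.intro)
    fix J H :: "real set" assume J: "J \<subseteq> H" and H: "finite H" "H \<subseteq> {0..1}"
    show "Q J = distr (Q H) (PiM J (\<lambda>_. borel)) (\<lambda>f. restrict f J)"
      unfolding Q_def using J restr[OF H(2)]
      by (subst distr_distr) (auto simp: comp_def Int_absorb1 intro!: measurable_restrict_subset)
  next
    fix J :: "real set" assume "finite J" "J \<subseteq> {0..1}"
    then show "prob_space (Q J)" unfolding Q_def by (intro prob_space_distr restr)
  qed
  define G where "G = projective_family.generator {0..1::real} (\<lambda>_. borel :: real measure)"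
  define C where "C = {A \<in> sets ?S. (emeasure (P \<theta>) A)\<^sup>2 \<le> ?K * emeasure (P \<eta>) A}"
  have fin: "prob_space (P \<phi>)" if "\<phi> \<in> L2_01" for \<phi>
    unfolding P_def by (intro prob_space_distr path that)
  have limit: "A \<in> C" if F: "range F \<subseteq> C" and A: "A \<in> sets ?S"
    and lim: "\<And>\<phi>. \<phi> \<in> L2_01 \<Longrightarrow> (\<lambda>i. emeasure (P \<phi>) (F i)) \<longlonglongrightarrow> emeasure (P \<phi>) A"
    for F :: "nat \<Rightarrow> _" and A
  proof -
    have "(emeasure (P \<theta>) A)\<^sup>2 \<le> ?K * emeasure (P \<eta>) A"
    proof (rule LIMSEQ_le)
      interpret P: prob_space "P \<theta>" by (rule fin[OF \<theta>])
      show "(\<lambda>i. (emeasure (P \<theta>) (F i))\<^sup>2) \<longlonglongrightarrow> (emeasure (P \<theta>) A)\<^sup>2"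
        unfolding power2_eq_square using lim[OF \<theta>]
        by (intro tendsto_mult_ennreal) auto
      show "(\<lambda>i. ?K * emeasure (P \<eta>) (F i)) \<longlonglongrightarrow> ?K * emeasure (P \<eta>) A"
        using lim[OF \<eta>] by (intro ennreal_tendsto_cmult) auto
      show "\<exists>N. \<forall>i\<ge>N. (emeasure (P \<theta>) (F i))\<^sup>2 \<le> ?K * emeasure (P \<eta>) (F i)"
        using F by (auto simp: C_def)
    qed
    with A show ?thesis by (simp add: C_def)
  qed
  have "sigma_sets (space ?S) G \<subseteq> C"
  proof (rule monotone_class_sigma_sets)
    show "algebra (space ?S) G" unfolding G_def by (rule projective_family.algebra_generator[OF pf])
    show "G \<subseteq> C"
    proof
      fix A assume "A \<in> G"
      then obtain J X where J: "finite J" "J \<subseteq> {0..1}" and X: "X \<in> sets (PiM J (\<lambda>_. borel))"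
        and A: "A = prod_emb {0..1} (\<lambda>_. borel) J X"
        unfolding G_def by (auto elim: projective_family.generator.cases[OF pf])
      have A_S: "A \<in> sets ?S" unfolding A using J X by (intro measurable_prod_emb) auto
      have "emeasure (P \<phi>) A = emeasure M {\<omega> \<in> space M. restrict (white_noise_path W n \<phi> \<omega>) J \<in> X}"
        if "\<phi> \<in> L2_01" for \<phi>
      proof -
        have "emeasure (P \<phi>) A = emeasure M (white_noise_path W n \<phi> -` A \<inter> space M)"
          unfolding P_def by (rule emeasure_distr[OF path(1)[OF that] A_S])
        also have "white_noise_path W n \<phi> -` A \<inter> space M =
            {\<omega> \<in> space M. restrict (white_noise_path W n \<phi> \<omega>) J \<in> X}"
          using measurable_space[OF path(1)[OF that]] by (auto simp: A prod_emb_def space_PiM)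
        finally show ?thesis .
      qed
      then show "A \<in> C"
        using A_S white_noise_cylinder_le[OF n \<theta> \<eta> J X] \<theta> \<eta> by (simp add: C_def)
    qed
  next
    fix F :: "nat \<Rightarrow> (real \<Rightarrow> real) set" assume F: "range F \<subseteq> C" "incseq F"
    then have sets: "F i \<in> sets ?S" for i by (auto simp: C_def)
    show "(\<Union>i. F i) \<in> C"
      using F sets by (intro limit[OF F(1)] Lim_emeasure_incseq sets.countable_UN) (auto simp: P_def)
  next
    fix F :: "nat \<Rightarrow> (real \<Rightarrow> real) set" assume F: "range F \<subseteq> C" "decseq F"
    then have sets: "F i \<in> sets ?S" for i by (auto simp: C_def)
    show "(\<Inter>i. F i) \<in> C"
    proof (rule limit[OF F(1)])
      fix \<phi> assume "\<phi> \<in> L2_01"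
      then interpret P: prob_space "P \<phi>" by (rule fin)
      show "(\<lambda>i. emeasure (P \<phi>) (F i)) \<longlonglongrightarrow> emeasure (P \<phi>) (\<Inter>i. F i)"
      proof (rule Lim_emeasure_decseq[OF _ F(2)])
        show "range F \<subseteq> sets (P \<phi>)" using sets by (auto simp: P_def)
      qed simp
    qed (use sets in \<open>auto intro: sets.countable_INT\<close>)
  qed
  then have C: "sets ?S \<subseteq> C"
    unfolding G_def projective_family.sets_PiM_generator[OF pf, symmetric] .
  obtain E' where E': "E' \<in> sets ?S" "E = {x. continuous_on {0..1} x} \<inter> E'"
    using E by (auto simp: C01_def sets_restrict_space)
  have "emeasure (white_noise_law M W n \<phi>) E = emeasure (P \<phi>) E'" if "\<phi> \<in> L2_01" for \<phi>
  proof -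
    have "emeasure (white_noise_law M W n \<phi>) E = emeasure M (white_noise_path W n \<phi> -` E \<inter> space M)"
      unfolding white_noise_law_def by (rule emeasure_distr[OF white_noise_path_measurable[OF that] E])
    also have "white_noise_path W n \<phi> -` E \<inter> space M = white_noise_path W n \<phi> -` E' \<inter> space M"
      using path(2)[OF that] by (auto simp: E')
    also have "emeasure M \<dots> = emeasure (P \<phi>) E'"
      unfolding P_def by (rule emeasure_distr[OF path(1)[OF that] E'(1), symmetric])
    finally show ?thesis .
  qed
  then show ?thesis using C E'(1) \<theta> \<eta> by (auto simp: C_def)
qed

end

section \<open>Exponential tails of linear functionals\<close>

lemma step_fun_inner:
  assumes "\<theta> \<in> L2_01"
  shows "l2_inner (step_fun J b) \<theta> = (\<Sum>t\<in>J. b t * primitive \<theta> t)"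
proof -
  have "l2_inner (step_fun J b) \<theta> = (\<integral>s. (\<Sum>t\<in>J. b t * (indicator {0..t} s * \<theta> s)) \<partial>leb01)"
    by (simp add: l2_inner_def step_fun_def sum_distrib_right mult.assoc)
  also have "\<dots> = (\<Sum>t\<in>J. \<integral>s. b t * (indicator {0..t} s * \<theta> s) \<partial>leb01)"
    by (intro Bochner_Integration.integral_sum integrable_mult_right integrable_L2_mult L2_01_indicator assms)
  finally show ?thesis by (simp add: primitive_def l2_inner_def)
qed

text \<open>At 0 the indicators of all intervals [0,t] equal 1, while those of the half-open
  intervals between consecutive knots vanish. The point 0 is the exception when a step function is
  rewritten over disjoint intervals.\<close>

lemma AE_leb01_nonzero: "AE s in leb01. s \<noteq> (0::real)"
proof -
  have "AE s in lebesgue. s \<noteq> (0::real)"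
    by (rule AE_completion[OF AE_lborel_singleton])
  then show ?thesis by (subst AE_restrict_space_iff) auto
qed

text \<open>Abel summation: the coefficient of an increment is the value of
  \<open>step_fun J b\<close> on the corresponding half-open interval. With a Brownian path as
  \<open>f\<close> it yields a sum of independent terms; with the indicator of [0,t] at a fixed s as
  \<open>f t\<close> it rewrites the step function over disjoint intervals.\<close>

lemma sum_by_parts_enumeration:
  fixes \<tau> b f :: "_ \<Rightarrow> real"
  assumes \<tau>: "strict_mono_on {..k::nat} \<tau>" "J \<subseteq> \<tau> ` {..k}" and J: "finite J" and f: "f (\<tau> 0) = 0"
  shows "(\<Sum>t\<in>J. b t * f t) =
    (\<Sum>l<k. (\<Sum>t | t \<in> J \<and> \<tau> (Suc l) \<le> t. b t) * (f (\<tau> (Suc l)) - f (\<tau> l)))"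
proof -
  have "(\<Sum>t\<in>J. b t * f t) =
      (\<Sum>t\<in>J. b t * (\<Sum>l | l \<in> {..<k} \<and> \<tau> (Suc l) \<le> t. f (\<tau> (Suc l)) - f (\<tau> l)))"
  proof (rule sum.cong[OF refl])
    fix t assume "t \<in> J"
    then obtain i where "i \<le> k" "t = \<tau> i" using \<tau>(2) by auto
    then show "b t * f t = b t * (\<Sum>l | l \<in> {..<k} \<and> \<tau> (Suc l) \<le> t. f (\<tau> (Suc l)) - f (\<tau> l))"
      using enumeration_telescope[OF \<tau>(1), of i f] f by simp
  qed
  also have "\<dots> = (\<Sum>t\<in>J. \<Sum>l | l \<in> {..<k} \<and> \<tau> (Suc l) \<le> t. b t * (f (\<tau> (Suc l)) - f (\<tau> l)))"
    by (simp add: sum_distrib_left)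
  also have "\<dots> = (\<Sum>l<k. \<Sum>t | t \<in> J \<and> \<tau> (Suc l) \<le> t. b t * (f (\<tau> (Suc l)) - f (\<tau> l)))"
    using J by (intro sum.swap_restrict) auto
  finally show ?thesis by (simp add: sum_distrib_right)
qed

lemma l2_norm_disjoint_steps:
  fixes \<tau> \<beta> :: "nat \<Rightarrow> real"
  assumes \<tau>: "strict_mono_on {..k} \<tau>" "\<tau> ` {..k} \<subseteq> {0..1}"
  defines "I \<equiv> \<lambda>l. indicat_real {\<tau> l<..\<tau> (Suc l)}"
  shows "(\<integral>s. (\<Sum>l<k. \<beta> l * I l s)\<^sup>2 \<partial>leb01) = (\<Sum>l<k. (\<beta> l)\<^sup>2 * (\<tau> (Suc l) - \<tau> l))"
proof -
  have in01: "\<tau> i \<in> {0..1}" if "i \<le> k" for i using \<tau>(2) that by blast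
  have le: "\<tau> l \<le> \<tau> j" if "l \<le> j" "j \<le> k" for l j
    using \<tau>(1) that unfolding strict_mono_on_def by (cases "l = j") (auto simp: le_less)
  have disj: "I l s * I j s = 0" if "l < k" "j < k" "l \<noteq> j" for l j s
    using le[of "Suc l" j] le[of "Suc j" l] that
    by (cases l j rule: linorder_cases) (auto simp: I_def indicator_def)
  have I2: "I l s * I l s = I l s" for l s by (simp add: I_def indicator_def)
  have "(\<Sum>l<k. \<beta> l * I l s)\<^sup>2 = (\<Sum>l<k. (\<beta> l)\<^sup>2 * I l s)" for s
  proof -
    have "(\<Sum>l<k. \<beta> l * I l s)\<^sup>2 = (\<Sum>l<k. \<Sum>j<k. (\<beta> l * I l s) * (\<beta> j * I j s))"
      by (simp add: power2_eq_square sum_product)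
    also have "\<dots> = (\<Sum>l<k. \<Sum>j<k. if j = l then (\<beta> l)\<^sup>2 * I l s else 0)"
    proof (intro sum.cong refl)
      fix l j assume lj: "l \<in> {..<k}" "j \<in> {..<k}"
      have "(\<beta> l * I l s) * (\<beta> j * I j s) = \<beta> l * \<beta> j * (I l s * I j s)" by (simp add: mult_ac)
      then show "(\<beta> l * I l s) * (\<beta> j * I j s) = (if j = l then (\<beta> l)\<^sup>2 * I l s else 0)"
        using disj[of l j s] lj I2[of l s] by (cases "j = l") (simp_all only: power2_eq_square if_True if_False, auto)
    qed
    finally show ?thesis by simp
  qed
  then have "(\<integral>s. (\<Sum>l<k. \<beta> l * I l s)\<^sup>2 \<partial>leb01) = (\<integral>s. (\<Sum>l<k. (\<beta> l)\<^sup>2 * I l s) \<partial>leb01)" by simp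
  also have "\<dots> = (\<Sum>l<k. \<integral>s. (\<beta> l)\<^sup>2 * I l s \<partial>leb01)"
    unfolding I_def
    by (intro Bochner_Integration.integral_sum integrable_mult_right integrable_L2 L2_01_indicator_borel) auto
  also have "\<dots> = (\<Sum>l<k. (\<beta> l)\<^sup>2 * (\<tau> (Suc l) - \<tau> l))"
  proof (intro sum.cong refl)
    fix l assume "l \<in> {..<k}"
    then have "0 \<le> \<tau> l" "\<tau> l \<le> \<tau> (Suc l)" "\<tau> (Suc l) \<le> 1"
      using in01[of l] in01[of "Suc l"] le[of l "Suc l"] by auto
    from integral_interval_leb01[OF this]
    show "(\<integral>s. (\<beta> l)\<^sup>2 * I l s \<partial>leb01) = (\<beta> l)\<^sup>2 * (\<tau> (Suc l) - \<tau> l)" by (simp add: I_def)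
  qed
  finally show ?thesis .
qed

context standard_brownian_motion
begin

text \<open>The exponent is the Wiener integral of the step function. In terms of increments it is a
  sum of independent centred normal variables whose variances add up to the squared norm of the step
  function, and exponential moments of independent variables multiply.\<close>

lemma exp_moment_linear:
  assumes J: "finite J" "J \<subseteq> {0..1}"
  shows "(\<integral>\<^sup>+\<omega>. ennreal (exp (\<Sum>t\<in>J. b t * W t \<omega>)) \<partial>M) = ennreal (exp ((l2_norm (step_fun J b))\<^sup>2 / 2))"
proof -
  obtain k \<tau> where k: "k \<ge> (1::nat)" and \<tau>: "strict_mono_on {..k} \<tau>" "\<tau> ` {..k} = insert 0 (insert 1 J)"
    "\<tau> 0 = 0" "\<tau> k = (1::real)"
    by (rule finite_set_enumeration[OF J])
  have sub: "\<tau> ` {..k} \<subseteq> {0..1}" "J \<subseteq> \<tau> ` {..k}" using \<tau>(2) J(2) by auto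
  have in01: "\<tau> i \<in> {0..1}" if "i \<le> k" for i using sub(1) that by blast
  have less: "\<tau> i < \<tau> (Suc i)" if "i < k" for i
    using \<tau>(1) that by (auto simp: strict_mono_on_def)
  define \<beta> where "\<beta> l = (\<Sum>t | t \<in> J \<and> \<tau> (Suc l) \<le> t. b t)" for l
  define X where "X l \<omega> = W (\<tau> (Suc l)) \<omega> - W (\<tau> l) \<omega>" for l \<omega>
  have norm: "(l2_norm (step_fun J b))\<^sup>2 = (\<Sum>l<k. (\<beta> l)\<^sup>2 * (\<tau> (Suc l) - \<tau> l))"
  proof -
    have [measurable]: "step_fun J b \<in> borel_measurable leb01"
      using step_fun_L2[of J b] by (simp add: L2_01_def)
    have [measurable]: "(\<lambda>s. indicat_real {\<tau> l<..\<tau> (Suc l)} s) \<in> borel_measurable leb01" for l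
      using L2_01_indicator_borel[of "{\<tau> l<..\<tau> (Suc l)}"] by (simp add: L2_01_def)
    have step: "step_fun J b s = (\<Sum>l<k. \<beta> l * indicator {\<tau> l<..\<tau> (Suc l)} s)" if "s \<noteq> 0" for s
    proof -
      \<comment> \<open>Summation by parts for the indicator of [0,t] at s as a function of t; that
        it vanishes at t = 0 is where s must differ from 0.\<close>
      have "step_fun J b s = (\<Sum>l<k. \<beta> l * (indicator {0..\<tau> (Suc l)} s - indicator {0..\<tau> l} s))"
        unfolding step_fun_def \<beta>_def
        by (rule sum_by_parts_enumeration[OF \<tau>(1) sub(2) J(1)]) (use \<tau>(3) that in \<open>auto simp: indicator_def\<close>)
      also have "\<dots> = (\<Sum>l<k. \<beta> l * indicator {\<tau> l<..\<tau> (Suc l)} s)"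
      proof (intro sum.cong refl arg_cong[where f = "\<lambda>x. _ * x"])
        fix l assume "l \<in> {..<k}"
        then show "indicat_real {0..\<tau> (Suc l)} s - indicator {0..\<tau> l} s = indicator {\<tau> l<..\<tau> (Suc l)} s"
          using less[of l] in01[of l] by (auto simp: indicator_def)
      qed
      finally show ?thesis .
    qed
    have "(l2_norm (step_fun J b))\<^sup>2 = (\<integral>s. (\<Sum>l<k. \<beta> l * indicator {\<tau> l<..\<tau> (Suc l)} s)\<^sup>2 \<partial>leb01)"
      unfolding l2_norm_power2 l2_inner_def
    proof (rule integral_cong_AE)
      show "AE s in leb01. step_fun J b s * step_fun J b s = (\<Sum>l<k. \<beta> l * indicator {\<tau> l<..\<tau> (Suc l)} s)\<^sup>2"
        using AE_leb01_nonzero by eventually_elim (simp add: step power2_eq_square)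
    qed measurable
    then show ?thesis unfolding l2_norm_disjoint_steps[OF \<tau>(1) sub(1)] .
  qed
  have exp_X: "(\<integral>\<^sup>+\<omega>. ennreal (exp (\<beta> l * X l \<omega>)) \<partial>M) = ennreal (exp ((\<beta> l)\<^sup>2 * (\<tau> (Suc l) - \<tau> l) / 2))"
    if l: "l < k" for l
  proof -
    have "distributed M lborel (X l) (normal_density 0 (sqrt (\<tau> (Suc l) - \<tau> l)))"
      unfolding X_def[abs_def]
      using less[of l] in01[of l] in01[of "Suc l"] l by (intro gaussian_increments) auto
    from distributed_nn_integral[OF this, of "\<lambda>x. ennreal (exp (\<beta> l * x))"]
    show ?thesis using less[OF l] by (simp add: nn_integral_normal_exp)
  qed
  have "indep_vars (\<lambda>_. borel) X {..<k}"
    unfolding X_def[abs_def] using sub(1) \<tau>(1) by (intro independent_increments strict_mono_on_imp_mono_on)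
  then have "indep_vars (\<lambda>_. borel) (\<lambda>l \<omega>. ennreal (exp (\<beta> l * X l \<omega>))) {..<k}"
    by (rule indep_vars_compose2) measurable
  then have "(\<integral>\<^sup>+\<omega>. (\<Prod>l<k. ennreal (exp (\<beta> l * X l \<omega>))) \<partial>M) =
      (\<Prod>l<k. \<integral>\<^sup>+\<omega>. ennreal (exp (\<beta> l * X l \<omega>)) \<partial>M)"
    by (intro indep_vars_nn_integral) auto
  also have "\<dots> = (\<Prod>l<k. ennreal (exp ((\<beta> l)\<^sup>2 * (\<tau> (Suc l) - \<tau> l) / 2)))"
    by (intro prod.cong refl exp_X) simp
  also have "\<dots> = ennreal (exp ((l2_norm (step_fun J b))\<^sup>2 / 2))"
    by (simp add: norm prod_ennreal exp_sum sum_divide_distrib)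
  also have "(\<integral>\<^sup>+\<omega>. (\<Prod>l<k. ennreal (exp (\<beta> l * X l \<omega>))) \<partial>M) =
      (\<integral>\<^sup>+\<omega>. ennreal (exp (\<Sum>t\<in>J. b t * W t \<omega>)) \<partial>M)"
  proof (rule nn_integral_cong)
    fix \<omega> assume "\<omega> \<in> space M"
    then have "(\<Sum>t\<in>J. b t * W t \<omega>) = (\<Sum>l<k. \<beta> l * X l \<omega>)"
      unfolding \<beta>_def X_def
      by (intro sum_by_parts_enumeration[OF \<tau>(1) sub(2) J(1)]) (simp add: \<tau>(3) starts_at_0)
    then show "(\<Prod>l<k. ennreal (exp (\<beta> l * X l \<omega>))) = ennreal (exp (\<Sum>t\<in>J. b t * W t \<omega>))"
      by (simp add: prod_ennreal exp_sum)
  qed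
  finally show ?thesis .
qed

lemma linear_functional_sets:
  assumes "finite J" "J \<subseteq> {0..1}"
  shows "(\<lambda>x. \<Sum>t\<in>J. b t * x t) \<in> borel_measurable C01"
proof -
  have "(\<lambda>x. x t) \<in> borel_measurable C01" if "t \<in> J" for t
    unfolding C01_def using assms that by (intro measurable_restrict_space1 measurable_component_singleton) auto
  then show ?thesis by (intro borel_measurable_sum borel_measurable_times borel_measurable_const)
qed

text \<open>Chernoff's bound: after centring, the functional is the Wiener integral of the step
  function divided by sqrt n.\<close>

lemma white_noise_law_linear_tail:
  assumes n: "n \<ge> 1" and \<theta>: "\<theta> \<in> L2_01" and J: "finite J" "J \<subseteq> {0..1}"
    and pos: "l2_norm (step_fun J b) > 0" and u: "u \<ge> 0"
  shows "emeasure (white_noise_law M W n \<theta>)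
      {x \<in> space C01. u \<le> (\<Sum>t\<in>J. b t * x t) - l2_inner (step_fun J b) \<theta>} \<le>
    ennreal (exp (- (real n * u\<^sup>2 / (2 * (l2_norm (step_fun J b))\<^sup>2))))" (is "emeasure _ ?A \<le> _")
proof -
  let ?h = "l2_norm (step_fun J b)"
  \<comment> \<open>The minimiser of c^2 |h|^2 / 2 - c sqrt(n) u, the exponent obtained from
    Markov's inequality for the exponential.\<close>
  define c where "c = sqrt (real n) * u / ?h\<^sup>2"
  have c: "c \<ge> 0" using u by (simp add: c_def)
  have [measurable]: "(\<lambda>\<omega>. \<Sum>t\<in>J. b t * W t \<omega>) \<in> borel_measurable M" for b
    using J(2) by (intro borel_measurable_sum borel_measurable_times borel_measurable_const measurable_W) auto
  have A: "?A \<in> sets C01"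
    using linear_functional_sets[OF J, of b] by measurable
  have S: "(\<Sum>t\<in>J. b t * white_noise_path W n \<theta> \<omega> t) - l2_inner (step_fun J b) \<theta> =
      (\<Sum>t\<in>J. b t * W t \<omega>) / sqrt (real n)" for \<omega>
  proof -
    have "(\<Sum>t\<in>J. b t * white_noise_path W n \<theta> \<omega> t) = (\<Sum>t\<in>J. b t * primitive \<theta> t + b t * W t \<omega> / sqrt (real n))"
      using J(2) by (intro sum.cong refl) (auto simp: white_noise_path_eq distrib_left)
    then show ?thesis by (simp add: step_fun_inner[OF \<theta>] sum.distrib sum_divide_distrib)
  qed
  have "emeasure (white_noise_law M W n \<theta>) ?A = emeasure M (white_noise_path W n \<theta> -` ?A \<inter> space M)"
    unfolding white_noise_law_def by (rule emeasure_distr[OF white_noise_path_measurable[OF \<theta>] A])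
  also have "white_noise_path W n \<theta> -` ?A \<inter> space M = {\<omega> \<in> space M. u \<le> (\<Sum>t\<in>J. b t * W t \<omega>) / sqrt (real n)}"
    using measurable_space[OF white_noise_path_measurable[OF \<theta>]] by (auto simp: S)
  also have "emeasure M \<dots> = (\<integral>\<^sup>+\<omega>. indicator {\<omega> \<in> space M. u \<le> (\<Sum>t\<in>J. b t * W t \<omega>) / sqrt (real n)} \<omega> \<partial>M)"
    by (rule nn_integral_indicator[symmetric]) measurable
  also have "\<dots> \<le> (\<integral>\<^sup>+\<omega>. ennreal (exp (- (c * sqrt (real n) * u))) * ennreal (exp (\<Sum>t\<in>J. (c * b t) * W t \<omega>)) \<partial>M)"
  proof (rule nn_integral_mono)
    fix \<omega>
    show "indicator {\<omega> \<in> space M. u \<le> (\<Sum>t\<in>J. b t * W t \<omega>) / sqrt (real n)} \<omega> \<le>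
      ennreal (exp (- (c * sqrt (real n) * u))) * ennreal (exp (\<Sum>t\<in>J. (c * b t) * W t \<omega>))"
    proof (cases "u \<le> (\<Sum>t\<in>J. b t * W t \<omega>) / sqrt (real n)")
      case True
      then have "sqrt (real n) * u \<le> (\<Sum>t\<in>J. b t * W t \<omega>)" using n by (simp add: field_simps)
      then have "c * (sqrt (real n) * u) \<le> c * (\<Sum>t\<in>J. b t * W t \<omega>)" using c by (rule mult_left_mono)
      then have "1 \<le> exp (- (c * sqrt (real n) * u) + (\<Sum>t\<in>J. (c * b t) * W t \<omega>))"
        by (simp add: sum_distrib_left mult.assoc)
      then have "1 \<le> ennreal (exp (- (c * sqrt (real n) * u)) * exp (\<Sum>t\<in>J. (c * b t) * W t \<omega>))"
        unfolding exp_add by simp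
      then show ?thesis
        by (simp add: ennreal_mult indicator_def)
    qed simp
  qed
  also have "\<dots> = ennreal (exp (- (c * sqrt (real n) * u))) * ennreal (exp ((l2_norm (step_fun J (\<lambda>t. c * b t)))\<^sup>2 / 2))"
    by (subst nn_integral_cmult) (measurable, simp only: exp_moment_linear[OF J])
  also have "step_fun J (\<lambda>t. c * b t) = (\<lambda>s. c * step_fun J b s)"
    by (auto simp: step_fun_def sum_distrib_left mult.assoc)
  also have "(l2_norm (\<lambda>s. c * step_fun J b s))\<^sup>2 = c\<^sup>2 * ?h\<^sup>2"
    by (simp add: l2_norm_cmult power_mult_distrib)
  also have "ennreal (exp (- (c * sqrt (real n) * u))) * ennreal (exp (c\<^sup>2 * ?h\<^sup>2 / 2)) =
      ennreal (exp (c\<^sup>2 * ?h\<^sup>2 / 2 - c * sqrt (real n) * u))"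
    by (simp flip: ennreal_mult exp_add)
  also have "c\<^sup>2 * ?h\<^sup>2 / 2 - c * sqrt (real n) * u = - (real n * u\<^sup>2 / (2 * ?h\<^sup>2))"
    using pos by (simp add: c_def power_mult_distrib power_divide field_simps)
      (simp add: power2_eq_square algebra_simps)
  finally show ?thesis .
qed

end

section \<open>Tests\<close>

context standard_brownian_motion
begin

text \<open>The distance required of \<open>c\<close> is j e minus the radius of the ball. Both
  error bounds are tails of one functional, given by a step function \<open>h\<close> close to c -
  theta0, so that no stochastic integral of a general function is needed.\<close>

lemma white_noise_test:
  assumes n: "n \<ge> 1" and L2: "\<theta>0 \<in> L2_01" "c \<in> L2_01" and e: "e > 0" and j: "j \<ge> 4"
    and far: "(7 * j - 1) * e / 8 \<le> l2_dist c \<theta>0"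
  obtains T where "T \<in> sets C01"
    "emeasure (white_noise_law M W n \<theta>0) T \<le> ennreal (exp (- (real n * e\<^sup>2 * j\<^sup>2 / 32)))"
    "\<And>\<theta>. \<theta> \<in> L2_01 \<Longrightarrow> l2_dist \<theta> c < (j + 1) * e / 8 \<Longrightarrow>
      emeasure (white_noise_law M W n \<theta>) (space C01 - T) \<le> ennreal (exp (- (real n * e\<^sup>2 * j\<^sup>2 / 32)))"
proof -
  let ?g = "\<lambda>s. c s - \<theta>0 s"
  have g: "?g \<in> L2_01" by (rule L2_01_diff[OF L2(2,1)])
  \<comment> \<open>The margin \<open>e / 24\<close> is the largest one for which the type II bound below holds down to \<open>j = 4\<close>.\<close>
  have "e / 24 > 0" using e by simp
  with step_approx_L2[OF g] obtain J b where J: "finite J" "J \<subseteq> {0..1}"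
    and close: "l2_dist (step_fun J b) ?g < e / 24"
    unfolding step_approx_def by meson
  define h where "h = step_fun J b"
  define H where "H = l2_norm h"
  have h: "h \<in> L2_01" unfolding h_def by (rule step_fun_L2)
  have "l2_norm ?g \<le> l2_norm (\<lambda>s. h s + (?g s - h s))" by simp
  also have "\<dots> \<le> H + l2_dist ?g h"
    unfolding H_def l2_dist_def by (intro l2_norm_add_le h L2_01_diff L2)
  finally have "(7 * j - 1) * e / 8 \<le> H + e / 24"
    using far close by (simp add: h_def l2_dist_def[of c] l2_dist_commute[of "step_fun J b"])
  \<comment> \<open>Cleared of denominators, H is at least (21 j - 4) e / 24. The type I error uses
    only the consequence H >= j e / 2; the type II error uses the full strength.\<close>
  then have H1: "21 * (j * e) - 4 * e \<le> 24 * H" by (simp add: field_simps)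
  have je: "4 * e \<le> j * e" using j e by simp
  have H2: "j * e / 2 \<le> H" using H1 je e by linarith
  have "0 < j * e / 2" using j e by simp
  with H2 have H_pos: "H > 0" by linarith
  define L where "L x = (\<Sum>t\<in>J. b t * x t)" for x :: "real \<Rightarrow> real"
  \<comment> \<open>The functional minus <h, theta0> has mean 0 under theta0, and would have mean
    \<open>H\<^sup>2\<close> if the parameter were theta0 + h; the threshold is halfway.\<close>
  define T where "T = {x \<in> space C01. H\<^sup>2 / 2 \<le> L x - l2_inner h \<theta>0}"
  have [measurable]: "L \<in> borel_measurable C01"
    unfolding L_def[abs_def] by (rule linear_functional_sets[OF J])
  have T: "T \<in> sets C01" unfolding T_def by measurable
  show ?thesis
  proof (rule that[OF T])
    have "emeasure (white_noise_law M W n \<theta>0) T \<le> ennreal (exp (- (real n * (H\<^sup>2 / 2)\<^sup>2 / (2 * H\<^sup>2))))"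
      using white_noise_law_linear_tail[OF n L2(1) J, of b "H\<^sup>2 / 2"] H_pos
      unfolding T_def L_def H_def h_def by simp
    also have "real n * (H\<^sup>2 / 2)\<^sup>2 / (2 * H\<^sup>2) = real n * H\<^sup>2 / 8"
      using H_pos by (simp add: power2_eq_square)
    also have "exp (- (real n * H\<^sup>2 / 8)) \<le> exp (- (real n * e\<^sup>2 * j\<^sup>2 / 32))"
    proof -
      have "(j * e / 2)\<^sup>2 \<le> H\<^sup>2" using H2 j e by (intro power_mono) auto
      then have "real n * (j * e / 2)\<^sup>2 \<le> real n * H\<^sup>2" by (rule mult_left_mono) simp
      then show ?thesis by (simp add: power_mult_distrib power_divide algebra_simps)
    qed
    finally show "emeasure (white_noise_law M W n \<theta>0) T \<le> ennreal (exp (- (real n * e\<^sup>2 * j\<^sup>2 / 32)))"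
      by (simp add: ennreal_leI)
  next
    fix \<theta> assume \<theta>: "\<theta> \<in> L2_01" and near: "l2_dist \<theta> c < (j + 1) * e / 8"
    \<comment> \<open>The type II error is a lower tail; negated coefficients turn it into an upper
      tail.\<close>
    have neg: "step_fun J (\<lambda>t. - b t) = (\<lambda>s. (-1) * h s)"
      by (auto simp: step_fun_def h_def sum_negf)
    have norm_neg: "l2_norm (step_fun J (\<lambda>t. - b t)) = H"
      unfolding neg l2_norm_cmult by (simp add: H_def)
    have inner_neg: "l2_inner (step_fun J (\<lambda>t. - b t)) \<theta> = - l2_inner h \<theta>"
      unfolding neg l2_inner_cmult by simp
    \<comment> \<open>Here theta - theta0 = h + ((c - theta0) - h) + (theta - c): a main term, the
      approximation error of \<open>h\<close>, and the displacement inside the ball.\<close>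
    have "l2_inner h \<theta> - l2_inner h \<theta>0 = l2_inner h (\<lambda>s. h s + ((?g s - h s) + (\<theta> s - c s)))"
      using \<theta> L2 h by (simp add: l2_inner_diff_right)
    also have "\<dots> = H\<^sup>2 + (l2_inner h (\<lambda>s. ?g s - h s) + l2_inner h (\<lambda>s. \<theta> s - c s))"
      unfolding H_def l2_norm_power2
      by (simp only: l2_inner_add_right L2_01_add L2_01_diff h L2 \<theta>)
    also have "\<dots> \<ge> H\<^sup>2 + (- (H * (e / 24)) - H * ((j + 1) * e / 8))"
    proof -
      have "\<bar>l2_inner h (\<lambda>s. ?g s - h s)\<bar> \<le> H * l2_dist ?g h"
        unfolding H_def l2_dist_def by (intro l2_Cauchy_Schwarz h L2_01_diff L2)
      also have "\<dots> \<le> H * (e / 24)"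
        using close H_pos by (intro mult_left_mono) (auto simp: h_def l2_dist_commute[of _ "step_fun J b"])
      finally have 1: "\<bar>l2_inner h (\<lambda>s. ?g s - h s)\<bar> \<le> H * (e / 24)" .
      have "\<bar>l2_inner h (\<lambda>s. \<theta> s - c s)\<bar> \<le> H * l2_dist \<theta> c"
        unfolding H_def l2_dist_def by (intro l2_Cauchy_Schwarz h L2_01_diff L2 \<theta>)
      also have "\<dots> \<le> H * ((j + 1) * e / 8)"
        using near H_pos by (intro mult_left_mono) auto
      finally show ?thesis using 1 by linarith
    qed
    finally have inner: "H\<^sup>2 - H * (e / 24) - H * ((j + 1) * e / 8) \<le> l2_inner h \<theta> - l2_inner h \<theta>0"
      by simp
    \<comment> \<open>By \<open>H1\<close> the expression is at least (3 j - 12) e / 48, which is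
      nonnegative exactly for j >= 4.\<close>
    have "0 \<le> H / 2 - e / 24 - (j + 1) * e / 8 - j * e / 4"
    proof -
      have "0 \<le> H / 2 - e / 24 - (X + e) / 8 - X / 4" if "21 * X - 4 * e \<le> 24 * H" "4 * e \<le> X" for X
        using that by (simp add: field_simps)
      from this[OF H1 je] show ?thesis by (simp add: distrib_right)
    qed
    then have gap: "0 \<le> H * (H / 2 - e / 24 - (j + 1) * e / 8 - j * e / 4)" using H_pos by simp
    then have u: "H * (j * e / 4) \<le> l2_inner h \<theta> - l2_inner h \<theta>0 - H\<^sup>2 / 2"
    proof -
      have *: "x * y \<le> z" if "0 \<le> x * (x / 2 - p - q - y)" "x\<^sup>2 - x * p - x * q \<le> z + x\<^sup>2 / 2" for x y z p q :: real
        using that by (simp add: algebra_simps power2_eq_square)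
      show ?thesis by (rule *[OF gap]) (use inner in simp)
    qed
    define A where "A = {x \<in> space C01. H * (j * e / 4) \<le> (\<Sum>t\<in>J. (- b t) * x t) - l2_inner (step_fun J (\<lambda>t. - b t)) \<theta>}"
    have "space C01 - T \<subseteq> A"
      unfolding A_def inner_neg using u by (auto simp: T_def L_def sum_negf)
    moreover have "A \<in> sets (white_noise_law M W n \<theta>)"
    proof -
      have [measurable]: "(\<lambda>x. \<Sum>t\<in>J. (- b t) * x t) \<in> borel_measurable C01"
        by (rule linear_functional_sets[OF J])
      have "A \<in> sets C01" unfolding A_def by measurable
      then show ?thesis by (simp add: white_noise_law_def)
    qed
    ultimately have "emeasure (white_noise_law M W n \<theta>) (space C01 - T) \<le> emeasure (white_noise_law M W n \<theta>) A"
      by (rule emeasure_mono)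
    also have "\<dots> \<le> ennreal (exp (- (real n * (H * (j * e / 4))\<^sup>2 / (2 * H\<^sup>2))))"
      using white_noise_law_linear_tail[OF n \<theta> J, of "\<lambda>t. - b t" "H * (j * e / 4)"] H_pos j e
      unfolding norm_neg A_def by simp
    also have "real n * (H * (j * e / 4))\<^sup>2 / (2 * H\<^sup>2) = real n * e\<^sup>2 * j\<^sup>2 / 32"
      using H_pos by (simp add: power2_eq_square)
    finally show "emeasure (white_noise_law M W n \<theta>) (space C01 - T) \<le> ennreal (exp (- (real n * e\<^sup>2 * j\<^sup>2 / 32)))" .
  qed
qed

text \<open>The rejection regions of the single balls are united. Their type I errors add up, whence
  the factor exp a, while the type II error at a parameter is bounded by that of the one test whose
  ball contains it.\<close>

lemma shell_test:
  assumes n: "n \<ge> 1" and L2: "\<theta>0 \<in> L2_01" "\<Theta> \<subseteq> L2_01" and e: "e > 0" and j: "j \<ge> 4"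
    and cover: "ln_enat (l2_covering_number ((j + 1) * e / 8) {\<theta> \<in> \<Theta>. l2_dist \<theta> \<theta>0 < (j + 1) * e}) \<le> ereal a"
  obtains T where "T \<in> sets C01"
    "emeasure (white_noise_law M W n \<theta>0) T \<le> ennreal (exp (a - real n * e\<^sup>2 * j\<^sup>2 / 32))"
    "\<And>\<theta>. \<theta> \<in> \<Theta> \<Longrightarrow> j * e \<le> l2_dist \<theta> \<theta>0 \<Longrightarrow> l2_dist \<theta> \<theta>0 < (j + 1) * e \<Longrightarrow>
      emeasure (white_noise_law M W n \<theta>) (space C01 - T) \<le> ennreal (exp (- (real n * e\<^sup>2 * j\<^sup>2 / 32)))"
proof -
  let ?A = "{\<theta> \<in> \<Theta>. l2_dist \<theta> \<theta>0 < (j + 1) * e}"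
  let ?r = "(j + 1) * e / 8"
  let ?x = "exp (- (real n * e\<^sup>2 * j\<^sup>2 / 32))"
  define S where "S = {F. finite F \<and> F \<subseteq> L2_01 \<and> ?A \<subseteq> (\<Union>c\<in>F. {f \<in> L2_01. l2_dist f c < ?r})}"
  have N: "l2_covering_number ?r ?A = (INF F\<in>S. enat (card F))"
    by (simp add: l2_covering_number_def S_def)
  \<comment> \<open>A finite bound on the logarithm excludes an infinite covering number, so finite
    covers exist and the infimum is attained.\<close>
  have "S \<noteq> {}"
  proof
    assume "S = {}"
    then have "l2_covering_number ?r ?A = \<infinity>" unfolding N by (simp add: top_enat_def)
    with cover show False by (simp add: ln_enat_def)
  qed
  then have "(INF F\<in>S. enat (card F)) \<in> (\<lambda>F. enat (card F)) ` S"
    unfolding Inf_enat_def by (auto intro: LeastI)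
  then obtain F where "F \<in> S" and card: "l2_covering_number ?r ?A = enat (card F)"
    unfolding N by auto
  then have F: "finite F" "F \<subseteq> L2_01" "?A \<subseteq> (\<Union>c\<in>F. {f \<in> L2_01. l2_dist f c < ?r})"
    by (auto simp: S_def)
  have card_le: "real (card F) \<le> exp a"
  proof (cases "card F = 0")
    case False
    then have "ln (real (card F)) \<le> a" using cover unfolding card by (simp add: ln_enat_def)
    with False show ?thesis by (metis exp_le_cancel_iff exp_ln of_nat_0_less_iff neq0_conv)
  qed simp
  have "\<exists>T. T \<in> sets C01 \<and> emeasure (white_noise_law M W n \<theta>0) T \<le> ennreal ?x \<and>
     (\<forall>\<theta>\<in>L2_01. j * e \<le> l2_dist \<theta> \<theta>0 \<longrightarrow> l2_dist \<theta> c < ?r \<longrightarrow>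
      emeasure (white_noise_law M W n \<theta>) (space C01 - T) \<le> ennreal ?x)" if c: "c \<in> F" for c
  proof (cases "(7 * j - 1) * e / 8 \<le> l2_dist c \<theta>0")
    case True
    have "c \<in> L2_01" using F(2) c by auto
    from white_noise_test[OF n L2(1) this e j True] show ?thesis by metis
  next
    case False
    \<comment> \<open>A ball with too close a centre misses the shell, because (7 j - 1) / 8 + (j +
      1) / 8 = j. The empty rejection region serves for it.\<close>
    have "\<not> (j * e \<le> l2_dist \<theta> \<theta>0 \<and> l2_dist \<theta> c < ?r)" if "\<theta> \<in> L2_01" for \<theta>
      using l2_dist_triangle[OF that _ L2(1), of c] F(2) c False by (auto simp: field_simps)
    then show ?thesis by (intro exI[of _ "{}"]) auto
  qed
  then obtain T where T: "\<And>c. c \<in> F \<Longrightarrow> T c \<in> sets C01"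
    "\<And>c. c \<in> F \<Longrightarrow> emeasure (white_noise_law M W n \<theta>0) (T c) \<le> ennreal ?x"
    "\<And>c \<theta>. c \<in> F \<Longrightarrow> \<theta> \<in> L2_01 \<Longrightarrow> j * e \<le> l2_dist \<theta> \<theta>0 \<Longrightarrow> l2_dist \<theta> c < ?r \<Longrightarrow>
      emeasure (white_noise_law M W n \<theta>) (space C01 - T c) \<le> ennreal ?x"
    by metis
  have law_sets: "sets (white_noise_law M W n \<theta>) = sets C01" for \<theta> by (simp add: white_noise_law_def)
  show ?thesis
  proof (rule that[of "\<Union>c\<in>F. T c"])
    show UN: "(\<Union>c\<in>F. T c) \<in> sets C01" using T(1) F(1) by auto
    have "emeasure (white_noise_law M W n \<theta>0) (\<Union>c\<in>F. T c) \<le> (\<Sum>c\<in>F. emeasure (white_noise_law M W n \<theta>0) (T c))"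
      using T(1) F(1) by (intro emeasure_subadditive_finite) (auto simp: law_sets)
    also have "\<dots> \<le> (\<Sum>c\<in>F. ennreal ?x)" by (intro sum_mono T(2))
    also have "\<dots> = ennreal (real (card F) * ?x)" by (simp add: ennreal_mult ennreal_of_nat_eq_real_of_nat)
    also have "\<dots> \<le> ennreal (exp a * ?x)" using card_le by (intro ennreal_leI mult_right_mono) auto
    also have "exp a * ?x = exp (a - real n * e\<^sup>2 * j\<^sup>2 / 32)" by (simp flip: exp_add)
    finally show "emeasure (white_noise_law M W n \<theta>0) (\<Union>c\<in>F. T c) \<le> ennreal (exp (a - real n * e\<^sup>2 * j\<^sup>2 / 32))" .
    fix \<theta> assume \<theta>: "\<theta> \<in> \<Theta>" "j * e \<le> l2_dist \<theta> \<theta>0" "l2_dist \<theta> \<theta>0 < (j + 1) * e"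
    then obtain c where c: "c \<in> F" "l2_dist \<theta> c < ?r" using F(3) by blast
    have "emeasure (white_noise_law M W n \<theta>) (space C01 - (\<Union>c\<in>F. T c)) \<le> emeasure (white_noise_law M W n \<theta>) (space C01 - T c)"
      using T(1) c by (intro emeasure_mono) (auto simp: law_sets)
    also have "\<dots> \<le> ennreal ?x" using \<theta> c L2(2) by (intro T(3)) auto
    finally show "emeasure (white_noise_law M W n \<theta>) (space C01 - (\<Union>c\<in>F. T c)) \<le> ennreal ?x" .
  qed
qed

end

section \<open>Posterior mass\<close>

lemma ennreal_divide_self_le_1: "x / x \<le> (1::ennreal)"
  by (cases "x = 0 \<or> x = \<top>") (auto simp: less_top)

text \<open>An inequality, since the total mass is ?D / ?D, which is 0 in \<open>ennreal\<close>
  where the denominator of Bayes' formula is 0 or infinite.\<close>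

lemma posterior_le_1:
  assumes [measurable]: "(\<lambda>\<theta>. p \<theta> x) \<in> borel_measurable \<pi>"
  shows "emeasure (posterior \<pi> p x) U \<le> 1"
proof -
  let ?D = "\<integral>\<^sup>+\<theta>. p \<theta> x \<partial>\<pi>"
  have "emeasure (posterior \<pi> p x) U \<le> emeasure (posterior \<pi> p x) (space (posterior \<pi> p x))"
    by (rule emeasure_space)
  also have "\<dots> = (\<integral>\<^sup>+\<theta>. p \<theta> x / ?D \<partial>\<pi>)"
    by (simp add: posterior_def emeasure_density cong: nn_integral_cong)
  also have "\<dots> = ?D / ?D"
    by (simp add: nn_integral_divide)
  also have "\<dots> \<le> 1"
    by (rule ennreal_divide_self_le_1)
  finally show ?thesis .
qed

lemma ennreal_square_le_mult_cancel:
  fixes x y :: ennreal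
  assumes "x\<^sup>2 \<le> y * x" "x \<noteq> \<top>"
  shows "x \<le> y"
proof (cases "x = 0")
  case False
  have "x * x \<le> x * y" using assms(1) by (simp add: power2_eq_square mult.commute)
  with False assms(2) show ?thesis by (simp add: ennreal_mult_le_mult_iff)
qed simp

text \<open>The sample space is split into \<open>T\<close>, the event E where the integral over
  \<open>B\<close> of the likelihood is at most s = t Pi(B) times the likelihood at theta0, and the
  rest, where the likelihood at theta0 over the denominator is at most 1/s. The hypothesis on
  \<open>K\<close> is applied to E itself: averaging over \<open>B\<close> gives P0(E)^2 Pi(B) <= K
  s P0(E), and a factor P0(E) cancels.\<close>

lemma posterior_mass_bound:
  fixes \<pi> :: "'t measure" and \<mu> :: "'x measure" and p :: "'t \<Rightarrow> 'x \<Rightarrow> ennreal"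
  assumes \<pi>: "prob_space \<pi>" and dens: "model_densities \<mu> \<pi> P p"
    and P0: "\<theta>\<^sub>0 \<in> space \<pi>" "prob_space (P \<theta>\<^sub>0)"
    and U: "U \<in> sets \<pi>" and B: "B \<in> sets \<pi>" "measure \<pi> B > 0"
    and T: "T \<in> sets \<mu>" and t: "t > 0"
    and K: "\<And>\<theta> E. \<theta> \<in> B \<Longrightarrow> E \<in> sets \<mu> \<Longrightarrow> (emeasure (P \<theta>\<^sub>0) E)\<^sup>2 \<le> K * emeasure (P \<theta>) E"
  shows "(\<integral>\<^sup>+x. emeasure (posterior \<pi> p x) U \<partial>P \<theta>\<^sub>0) \<le>
    emeasure (P \<theta>\<^sub>0) T + K * ennreal t +
    (\<integral>\<^sup>+\<theta>. indicator U \<theta> * emeasure (P \<theta>) (space \<mu> - T) \<partial>\<pi>) / ennreal (t * measure \<pi> B)"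
proof -
  interpret \<pi>: prob_space \<pi> by fact
  interpret \<mu>: sigma_finite_measure \<mu> using dens by (simp add: model_densities_def)
  interpret pair_sigma_finite \<pi> \<mu> ..
  have p[measurable]: "(\<lambda>(\<theta>, x). p \<theta> x) \<in> borel_measurable (\<pi> \<Otimes>\<^sub>M \<mu>)"
    and P: "\<And>\<theta>. \<theta> \<in> space \<pi> \<Longrightarrow> P \<theta> = density \<mu> (p \<theta>)"
    using dens by (auto simp: model_densities_def)
  note [measurable] = U B(1) T
  have p1[measurable]: "p \<theta> \<in> borel_measurable \<mu>" if "\<theta> \<in> space \<pi>" for \<theta>
    using measurable_Pair2[OF p that] by simp
  have p2[measurable]: "(\<lambda>\<theta>. p \<theta> x) \<in> borel_measurable \<pi>" if "x \<in> space \<mu>" for x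
    using measurable_Pair1[OF p that] by simp
  note [measurable] = p1[OF P0(1)]
  define s where "s = ennreal (t * measure \<pi> B)"
  have s: "s \<noteq> 0" "s \<noteq> \<top>" using t B(2) by (auto simp: s_def)
  have s_eq: "s = ennreal t * emeasure \<pi> B"
    using t by (simp add: s_def \<pi>.emeasure_eq_measure ennreal_mult)
  have p_swap[measurable]: "(\<lambda>(x, \<theta>). p \<theta> x) \<in> borel_measurable (\<mu> \<Otimes>\<^sub>M \<pi>)"
    using p by (subst measurable_pair_swap_iff) (simp add: case_prod_beta)
  have [measurable]: "(\<lambda>x. \<integral>\<^sup>+\<theta>. indicator A \<theta> * p \<theta> x \<partial>\<pi>) \<in> borel_measurable \<mu>" if [measurable]: "A \<in> sets \<pi>" for A
    by (rule \<pi>.borel_measurable_nn_integral) measurable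
  define q where "q A x = (\<integral>\<^sup>+\<theta>. indicator A \<theta> * p \<theta> x \<partial>\<pi>)" for A x
  have q[measurable]: "q A \<in> borel_measurable \<mu>" if [measurable]: "A \<in> sets \<pi>" for A
    unfolding q_def[abs_def] by measurable
  \<comment> \<open>Fubini: integrating the partial evidence \<open>q A\<close> over an event
    averages the laws of that event over the parameters in \<open>A\<close>.\<close>
  have fub: "(\<integral>\<^sup>+x. indicator E x * q A x \<partial>\<mu>) = (\<integral>\<^sup>+\<theta>. indicator A \<theta> * emeasure (P \<theta>) E \<partial>\<pi>)"
    if [measurable]: "A \<in> sets \<pi>" "E \<in> sets \<mu>" for A E
  proof -
    have "(\<integral>\<^sup>+x. indicator E x * q A x \<partial>\<mu>) =
        (\<integral>\<^sup>+x. (\<integral>\<^sup>+\<theta>. indicator E x * (indicator A \<theta> * p \<theta> x) \<partial>\<pi>) \<partial>\<mu>)"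
      unfolding q_def by (intro nn_integral_cong nn_integral_cmult[symmetric]) measurable
    also have "\<dots> = (\<integral>\<^sup>+\<theta>. (\<integral>\<^sup>+x. indicator E x * (indicator A \<theta> * p \<theta> x) \<partial>\<mu>) \<partial>\<pi>)"
      by (rule Fubini') measurable
    also have "\<dots> = (\<integral>\<^sup>+\<theta>. indicator A \<theta> * emeasure (P \<theta>) E \<partial>\<pi>)"
    proof (rule nn_integral_cong)
      fix \<theta> assume \<theta>: "\<theta> \<in> space \<pi>"
      note [measurable] = p1[OF \<theta>]
      have "(\<integral>\<^sup>+x. indicator E x * (indicator A \<theta> * p \<theta> x) \<partial>\<mu>) = indicator A \<theta> * (\<integral>\<^sup>+x. p \<theta> x * indicator E x \<partial>\<mu>)"
        by (subst nn_integral_cmult[symmetric]) (auto simp: mult_ac)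
      then show "(\<integral>\<^sup>+x. indicator E x * (indicator A \<theta> * p \<theta> x) \<partial>\<mu>) = indicator A \<theta> * emeasure (P \<theta>) E"
        by (simp add: P[OF \<theta>] emeasure_density)
    qed
    finally show ?thesis .
  qed
  define E where "E = {x \<in> space \<mu>. q B x \<le> s * p \<theta>\<^sub>0 x}"
  have [measurable]: "E \<in> sets \<mu>" unfolding E_def by measurable
  have P0_density: "emeasure (P \<theta>\<^sub>0) A = (\<integral>\<^sup>+x. indicator A x * p \<theta>\<^sub>0 x \<partial>\<mu>)" if "A \<in> sets \<mu>" for A
    using that by (simp add: P[OF P0(1)] emeasure_density mult.commute)
  have P0_E: "emeasure (P \<theta>\<^sub>0) E \<le> K * ennreal t"
  proof (rule ennreal_square_le_mult_cancel)
    interpret P0: prob_space "P \<theta>\<^sub>0" by fact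
    show "emeasure (P \<theta>\<^sub>0) E \<noteq> \<top>" by simp
    have "(emeasure (P \<theta>\<^sub>0) E)\<^sup>2 * emeasure \<pi> B = (\<integral>\<^sup>+\<theta>. indicator B \<theta> * (emeasure (P \<theta>\<^sub>0) E)\<^sup>2 \<partial>\<pi>)"
      by (simp add: nn_integral_multc mult.commute)
    also have "\<dots> \<le> (\<integral>\<^sup>+\<theta>. K * (indicator B \<theta> * emeasure (P \<theta>) E) \<partial>\<pi>)"
      by (intro nn_integral_mono) (auto simp: indicator_def K)
    also have "\<dots> = K * (\<integral>\<^sup>+\<theta>. indicator B \<theta> * emeasure (P \<theta>) E \<partial>\<pi>)"
    proof (rule nn_integral_cmult)
      have "(\<lambda>\<theta>. \<integral>\<^sup>+x. p \<theta> x * indicator E x \<partial>\<mu>) \<in> borel_measurable \<pi>"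
        by (rule \<mu>.borel_measurable_nn_integral) measurable
      then have "(\<lambda>\<theta>. emeasure (P \<theta>) E) \<in> borel_measurable \<pi>"
        by (rule measurable_cong[THEN iffD1, rotated]) (simp add: P emeasure_density)
      then show "(\<lambda>\<theta>. indicator B \<theta> * emeasure (P \<theta>) E) \<in> borel_measurable \<pi>" by measurable
    qed
    also have "\<dots> = K * (\<integral>\<^sup>+x. indicator E x * q B x \<partial>\<mu>)" by (simp add: fub)
    also have "\<dots> \<le> K * (\<integral>\<^sup>+x. s * (indicator E x * p \<theta>\<^sub>0 x) \<partial>\<mu>)"
      by (intro mult_left_mono nn_integral_mono) (auto simp: E_def indicator_def)
    also have "\<dots> = K * (s * emeasure (P \<theta>\<^sub>0) E)"
      by (simp add: nn_integral_cmult P0_density)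
    also have "\<dots> = K * ennreal t * emeasure (P \<theta>\<^sub>0) E * emeasure \<pi> B"
      by (simp add: s_eq mult_ac)
    finally have "emeasure \<pi> B * (emeasure (P \<theta>\<^sub>0) E)\<^sup>2 \<le> emeasure \<pi> B * (K * ennreal t * emeasure (P \<theta>\<^sub>0) E)"
      by (simp add: mult_ac)
    moreover have "emeasure \<pi> B \<noteq> 0" "emeasure \<pi> B \<noteq> \<top>"
      using B(2) by (auto simp: \<pi>.emeasure_eq_measure)
    ultimately show "(emeasure (P \<theta>\<^sub>0) E)\<^sup>2 \<le> K * ennreal t * emeasure (P \<theta>\<^sub>0) E"
      by (simp add: ennreal_mult_le_mult_iff)
  qed
  define D where "D x = (\<integral>\<^sup>+\<theta>. p \<theta> x \<partial>\<pi>)" for x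
  have D[measurable]: "D \<in> borel_measurable \<mu>"
    unfolding D_def[abs_def] by (rule \<pi>.borel_measurable_nn_integral) measurable
  have post: "emeasure (posterior \<pi> p x) U = q U x / D x" if x: "x \<in> space \<mu>" for x
  proof -
    note [measurable] = p2[OF x]
    have "emeasure (posterior \<pi> p x) U = (\<integral>\<^sup>+\<theta>. (indicator U \<theta> * p \<theta> x) / D x \<partial>\<pi>)"
      unfolding posterior_def D_def[symmetric]
      by (subst emeasure_density) (auto intro!: nn_integral_cong simp: indicator_def)
    then show ?thesis by (simp add: nn_integral_divide q_def)
  qed
  have bound: "q U x / D x * p \<theta>\<^sub>0 x \<le>
      indicator T x * p \<theta>\<^sub>0 x + indicator E x * p \<theta>\<^sub>0 x + indicator (space \<mu> - T) x * q U x / s"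
    if x: "x \<in> space \<mu>" for x
  proof (cases "x \<in> T \<or> x \<in> E")
    case True
    have "q U x / D x \<le> 1" using posterior_le_1[of p x \<pi> U, OF p2[OF x]] post[OF x] by simp
    then have "q U x / D x * p \<theta>\<^sub>0 x \<le> 1 * p \<theta>\<^sub>0 x" by (rule mult_right_mono) simp
    also have "1 * p \<theta>\<^sub>0 x \<le> indicator T x * p \<theta>\<^sub>0 x + indicator E x * p \<theta>\<^sub>0 x"
      using True by (auto simp: add_increasing add_increasing2)
    also have "\<dots> \<le> \<dots> + indicator (space \<mu> - T) x * q U x / s" by simp
    finally show ?thesis .
  next
    case False
    then have "s * p \<theta>\<^sub>0 x \<le> q B x" using x by (simp add: E_def not_le less_imp_le)
    also have "\<dots> \<le> D x" unfolding q_def D_def by (intro nn_integral_mono) (auto simp: indicator_def)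
    finally have "s * p \<theta>\<^sub>0 x / D x \<le> D x / D x" by (rule divide_right_mono_ennreal)
    also have "\<dots> \<le> 1" by (rule ennreal_divide_self_le_1)
    finally have "q U x * (s * p \<theta>\<^sub>0 x / D x) \<le> q U x * 1" by (rule mult_left_mono) simp
    then have "(s * (q U x / D x * p \<theta>\<^sub>0 x)) / s \<le> q U x / s"
      by (intro divide_right_mono_ennreal) (simp add: divide_ennreal_def mult_ac)
    also have "(s * (q U x / D x * p \<theta>\<^sub>0 x)) / s = q U x / D x * p \<theta>\<^sub>0 x"
      using s by (metis ennreal_mult_divide_eq mult.commute)
    finally show ?thesis using False x by simp
  qed
  have "(\<integral>\<^sup>+x. emeasure (posterior \<pi> p x) U \<partial>P \<theta>\<^sub>0) = (\<integral>\<^sup>+x. q U x / D x \<partial>P \<theta>\<^sub>0)"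
    by (intro nn_integral_cong) (simp add: post P[OF P0(1)])
  also have "\<dots> = (\<integral>\<^sup>+x. p \<theta>\<^sub>0 x * (q U x / D x) \<partial>\<mu>)"
    unfolding P[OF P0(1)] by (rule nn_integral_density) measurable
  also have "\<dots> \<le> (\<integral>\<^sup>+x. indicator T x * p \<theta>\<^sub>0 x + indicator E x * p \<theta>\<^sub>0 x + indicator (space \<mu> - T) x * q U x / s \<partial>\<mu>)"
    using bound by (intro nn_integral_mono) (simp add: mult.commute)
  also have "\<dots> = emeasure (P \<theta>\<^sub>0) T + emeasure (P \<theta>\<^sub>0) E +
      (\<integral>\<^sup>+\<theta>. indicator U \<theta> * emeasure (P \<theta>) (space \<mu> - T) \<partial>\<pi>) / s"
    by (simp add: nn_integral_add nn_integral_divide P0_density fub)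
  also have "\<dots> \<le> emeasure (P \<theta>\<^sub>0) T + K * ennreal t +
      (\<integral>\<^sup>+\<theta>. indicator U \<theta> * emeasure (P \<theta>) (space \<mu> - T) \<partial>\<pi>) / s"
    using P0_E by (intro add_mono order_refl)
  finally show ?thesis unfolding s_def .
qed

section \<open>Posterior contraction\<close>

text \<open>The surplus j^2 / 32 - j^2 / 64 = j^2 / 64 is spent in quarters: one pays for C, two pay
  for (2 j + 1) / 64, which is possible because j >= 5, and one remains. The remainder is weakened
  from j^2 to j so that the shells sum to a geometric series.\<close>

lemma shell_exponent_le:
  fixes a c C j :: real
  assumes a: "c \<le> a" "0 < c" and C: "256 * C \<le> j\<^sup>2" and j: "5 \<le> j"
  shows "a * (C + (j + 1)\<^sup>2 / 64 - j\<^sup>2 / 32) \<le> - (c * j / 256)"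
proof -
  have "j * 5 \<le> j * j" using j by (intro mult_left_mono) auto
  then have j2: "5 * j \<le> j\<^sup>2" by (simp add: power2_eq_square)
  have "C + (j + 1)\<^sup>2 / 64 - j\<^sup>2 / 32 \<le> - (j\<^sup>2 / 256)"
  proof -
    have "(j + 1)\<^sup>2 = j\<^sup>2 + 2 * j + 1" by (simp add: power2_sum)
    then show ?thesis using C j2 j by linarith
  qed
  also have "\<dots> \<le> - (j / 256)" using j2 j by simp
  finally have "a * (C + (j + 1)\<^sup>2 / 64 - j\<^sup>2 / 32) \<le> a * (- (j / 256))"
    using a by (intro mult_left_mono) auto
  also have "\<dots> \<le> c * (- (j / 256))"
    using a j by (intro mult_right_mono_neg) auto
  finally show ?thesis by simp
qed

lemma suminf_exp_tail:
  assumes c: "c > (0::real)"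
  shows "(\<Sum>i. ennreal (exp (- (c * real (J + i) / 256)))) = ennreal (exp (- (c * real J / 256)) / (1 - exp (- (c / 256))))"
proof -
  let ?r = "exp (- (c / 256))"
  have "exp (- (c * real (J + i) / 256)) = exp (- (c * real J / 256)) * ?r ^ i" for i
    by (simp add: exp_of_nat_mult[symmetric] flip: exp_add) (simp add: algebra_simps)
  moreover have "(\<lambda>i. exp (- (c * real J / 256)) * ?r ^ i) sums (exp (- (c * real J / 256)) * (1 / (1 - ?r)))"
    using c by (intro sums_mult geometric_sums) simp
  ultimately show ?thesis
    by (simp add: sums_unique[symmetric] suminf_ennreal_eq)
qed

text \<open>Stated for a single n, which enters the right-hand side only through the lower bound
  \<open>c\<close> of n e^2; this makes the limit argument uniform. The factor 2 counts one
  geometric tail for each type of error.\<close>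

lemma white_noise_posterior_bound:
  fixes M :: "'w measure" and \<pi> :: "(real \<Rightarrow> real) measure" and e a c C m :: real and J :: nat
  assumes bm: "standard_brownian_motion M W" and \<Theta>: "\<Theta> \<subseteq> L2_01" and \<theta>0: "\<theta>0 \<in> \<Theta>"
    and n: "n \<ge> 1" and \<pi>: "prob_space \<pi>" and space: "space \<pi> = \<Theta>"
    and meas: "(\<lambda>\<theta>. l2_dist \<theta> \<theta>0) \<in> borel_measurable \<pi>"
    and dens: "model_densities \<mu> \<pi> (white_noise_law M W n) p"
    and e: "e > 0" and a: "a = real n * e\<^sup>2" and ac: "c \<le> a" "0 < c"
    and cover: "(SUP \<delta> \<in> {e<..}. ln_enat (l2_covering_number (\<delta> / 8) {\<theta> \<in> \<Theta>. l2_dist \<theta> \<theta>0 < \<delta>})) \<le> ereal a"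
    and pos: "measure \<pi> {\<theta> \<in> \<Theta>. l2_dist \<theta> \<theta>0 \<le> e} > 0"
    and ratio: "\<And>j::nat. measure \<pi> {\<theta> \<in> \<Theta>. l2_dist \<theta> \<theta>0 \<le> real j * e} /
        measure \<pi> {\<theta> \<in> \<Theta>. l2_dist \<theta> \<theta>0 \<le> e} \<le> exp (a * (real j)\<^sup>2 / 64)"
    and C: "C \<ge> 1" and J: "J \<ge> 5" "256 * C \<le> (real J)\<^sup>2" "real J \<le> m"
  shows "(\<integral>\<^sup>+x. emeasure (posterior \<pi> p x) {\<theta> \<in> \<Theta>. l2_dist \<theta> \<theta>0 \<ge> m * e} \<partial>white_noise_law M W n \<theta>0) \<le>
    ennreal (exp (- ((C - 1) * c)) + 2 * (exp (- (c * real J / 256)) / (1 - exp (- (c / 256)))))"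
proof -
  interpret standard_brownian_motion M W by fact
  interpret \<pi>: prob_space \<pi> by fact
  let ?P = "white_noise_law M W n"
  let ?d = "\<lambda>\<theta>. l2_dist \<theta> \<theta>0"
  let ?s = "exp (- (c * real J / 256)) / (1 - exp (- (c / 256)))"
  note [measurable] = meas
  have \<theta>0_L2: "\<theta>0 \<in> L2_01" using \<Theta> \<theta>0 by auto
  \<comment> \<open>A density has the sigma-algebra of its base measure, so the dominating measure
    shares that of the laws.\<close>
  have sets_\<mu>: "sets \<mu> = sets C01"
  proof -
    have "?P \<theta>0 = density \<mu> (p \<theta>0)" using dens \<theta>0 space by (simp add: model_densities_def)
    then have "sets (?P \<theta>0) = sets \<mu>" by simp
    then show ?thesis by (simp add: white_noise_law_def)
  qed
  have space_\<mu>: "space \<mu> = space C01" by (rule sets_eq_imp_space_eq[OF sets_\<mu>])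
  define S where "S r = {\<theta> \<in> \<Theta>. ?d \<theta> \<le> r}" for r
  have S[measurable]: "S r \<in> sets \<pi>" for r unfolding S_def space[symmetric] by measurable
  define U where "U = {\<theta> \<in> \<Theta>. ?d \<theta> \<ge> m * e}"
  have U: "U \<in> sets \<pi>" unfolding U_def space[symmetric] by measurable
  have "\<exists>T. T \<in> sets C01 \<and> emeasure (?P \<theta>0) T \<le> ennreal (exp (a - a * (real (J + i))\<^sup>2 / 32)) \<and>
      (\<forall>\<theta>\<in>\<Theta>. real (J + i) * e \<le> ?d \<theta> \<longrightarrow> ?d \<theta> < (real (J + i) + 1) * e \<longrightarrow>
        emeasure (?P \<theta>) (space C01 - T) \<le> ennreal (exp (- (a * (real (J + i))\<^sup>2 / 32))))" for i
  proof -
    have 4: "4 \<le> real (J + i)" using J(1) by simp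
    have cover_i: "ln_enat (l2_covering_number ((real (J + i) + 1) * e / 8)
        {\<theta> \<in> \<Theta>. ?d \<theta> < (real (J + i) + 1) * e}) \<le> ereal a"
    proof (rule order_trans[OF SUP_upper cover])
      have "1 * e < (real (J + i) + 1) * e" using e J(1) by (intro mult_strict_right_mono) auto
      then show "(real (J + i) + 1) * e \<in> {e<..}" by simp
    qed
    obtain T where "T \<in> sets C01"
      "emeasure (?P \<theta>0) T \<le> ennreal (exp (a - real n * e\<^sup>2 * (real (J + i))\<^sup>2 / 32))"
      "\<And>\<theta>. \<theta> \<in> \<Theta> \<Longrightarrow> real (J + i) * e \<le> ?d \<theta> \<Longrightarrow> ?d \<theta> < (real (J + i) + 1) * e \<Longrightarrow>
        emeasure (?P \<theta>) (space C01 - T) \<le> ennreal (exp (- (real n * e\<^sup>2 * (real (J + i))\<^sup>2 / 32)))"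
      by (rule shell_test[OF n \<theta>0_L2 \<Theta> e 4 cover_i]) blast
    then show ?thesis unfolding a by blast
  qed
  then obtain T where T: "\<And>i. T i \<in> sets C01"
    "\<And>i. emeasure (?P \<theta>0) (T i) \<le> ennreal (exp (a - a * (real (J + i))\<^sup>2 / 32))"
    "\<And>i \<theta>. \<theta> \<in> \<Theta> \<Longrightarrow> real (J + i) * e \<le> ?d \<theta> \<Longrightarrow> ?d \<theta> < (real (J + i) + 1) * e \<Longrightarrow>
        emeasure (?P \<theta>) (space C01 - T i) \<le> ennreal (exp (- (a * (real (J + i))\<^sup>2 / 32)))"
    by metis
  define T' where "T' = (\<Union>i. T i)"
  have T': "T' \<in> sets C01" unfolding T'_def using T(1) by auto
  have law_sets: "sets (?P \<theta>) = sets C01" for \<theta> by (simp add: white_noise_law_def)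
  have ac0: "a > 0" using ac by simp
  have exponent: "a * (C + (real (J + i) + 1)\<^sup>2 / 64 - (real (J + i))\<^sup>2 / 32) \<le> - (c * real (J + i) / 256)" for i
  proof (rule shell_exponent_le[OF ac])
    have "(real J)\<^sup>2 \<le> (real (J + i))\<^sup>2" by (intro power_mono) auto
    with J(2) show "256 * C \<le> (real (J + i))\<^sup>2" by linarith
  qed (use J(1) in simp)
  have le_suminf: "f i \<le> (\<Sum>i. f i)" for f :: "nat \<Rightarrow> ennreal" and i
    using sum_le_suminf[of f "{i}"] by simp
  have type1: "emeasure (?P \<theta>0) T' \<le> ennreal ?s"
  proof -
    have "emeasure (?P \<theta>0) T' \<le> (\<Sum>i. emeasure (?P \<theta>0) (T i))"
      unfolding T'_def using T(1) by (intro emeasure_subadditive_countably) (auto simp: law_sets)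
    also have "\<dots> \<le> (\<Sum>i. ennreal (exp (- (c * real (J + i) / 256))))"
    proof (intro suminf_le summableI)
      fix i
      \<comment> \<open>Since C >= 1, this exponent is at most the one met in the type II part, so
        the same series bounds both.\<close>
      have "a * (1 - (real (J + i))\<^sup>2 / 32) \<le> a * (C + (real (J + i) + 1)\<^sup>2 / 64 - (real (J + i))\<^sup>2 / 32)"
        using C ac0 by (intro mult_left_mono) (auto intro: add_increasing2)
      also note exponent
      finally have "a - a * (real (J + i))\<^sup>2 / 32 \<le> - (c * real (J + i) / 256)"
        by (simp add: right_diff_distrib)
      then show "emeasure (?P \<theta>0) (T i) \<le> ennreal (exp (- (c * real (J + i) / 256)))"
        using T(2)[of i] by (meson ennreal_leI exp_le_cancel_iff order_trans)
    qed
    finally show ?thesis unfolding suminf_exp_tail[OF ac(2)] .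
  qed
  have type2: "(\<integral>\<^sup>+\<theta>. indicator U \<theta> * emeasure (?P \<theta>) (space \<mu> - T') \<partial>\<pi>) / ennreal (exp (- (C * a)) * measure \<pi> (S e)) \<le> ennreal ?s"
  proof -
    \<comment> \<open>A parameter in \<open>U\<close> lies in the shell whose index is the integer
      part of its distance divided by \<open>e\<close>, and that index is at least \<open>J\<close>.
      Each shell is enlarged to the ball of its outer radius, because the hypothesis on the prior
      concerns balls.\<close>
    have "indicator U \<theta> * emeasure (?P \<theta>) (space \<mu> - T') \<le>
        (\<Sum>i. indicator (S ((real (J + i) + 1) * e)) \<theta> * ennreal (exp (- (a * (real (J + i))\<^sup>2 / 32))))" for \<theta>
    proof (cases "\<theta> \<in> U")
      case True
      then have \<theta>: "\<theta> \<in> \<Theta>" "m * e \<le> ?d \<theta>" by (auto simp: U_def)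
      define k where "k = nat \<lfloor>?d \<theta> / e\<rfloor>"
      have "real J \<le> ?d \<theta> / e"
        using order_trans[OF mult_right_mono[OF J(3) less_imp_le[OF e]] \<theta>(2)] e by (simp add: field_simps)
      then have "J \<le> k" unfolding k_def by (simp add: le_nat_floor)
      then obtain i where i: "k = J + i" using le_Suc_ex by blast
      have nonneg: "0 \<le> ?d \<theta> / e" using e by simp
      have "real k \<le> ?d \<theta> / e" unfolding k_def using nonneg by (simp add: of_nat_floor)
      then have lo: "real (J + i) * e \<le> ?d \<theta>" using e i by (simp add: field_simps)
      have "?d \<theta> / e < real k + 1" unfolding k_def using nonneg by linarith
      then have hi: "?d \<theta> < (real (J + i) + 1) * e" using e i by (simp add: field_simps)
      have "indicator U \<theta> * emeasure (?P \<theta>) (space \<mu> - T') \<le> emeasure (?P \<theta>) (space C01 - T i)"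
        using True T(1) by (auto simp: space_\<mu> T'_def law_sets intro!: emeasure_mono)
      also have "\<dots> \<le> indicator (S ((real (J + i) + 1) * e)) \<theta> * ennreal (exp (- (a * (real (J + i))\<^sup>2 / 32)))"
        using T(3)[OF \<theta>(1) lo hi] \<theta>(1) hi by (simp add: S_def)
      also have "\<dots> \<le> (\<Sum>i. indicator (S ((real (J + i) + 1) * e)) \<theta> * ennreal (exp (- (a * (real (J + i))\<^sup>2 / 32))))"
        by (rule le_suminf[of "\<lambda>i. indicator (S ((real (J + i) + 1) * e)) \<theta> * ennreal (exp (- (a * (real (J + i))\<^sup>2 / 32)))"])
      finally show ?thesis .
    qed simp
    then have "(\<integral>\<^sup>+\<theta>. indicator U \<theta> * emeasure (?P \<theta>) (space \<mu> - T') \<partial>\<pi>) \<le>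
        (\<integral>\<^sup>+\<theta>. (\<Sum>i. indicator (S ((real (J + i) + 1) * e)) \<theta> * ennreal (exp (- (a * (real (J + i))\<^sup>2 / 32)))) \<partial>\<pi>)"
      by (intro nn_integral_mono)
    also have "\<dots> = (\<Sum>i. emeasure \<pi> (S ((real (J + i) + 1) * e)) * ennreal (exp (- (a * (real (J + i))\<^sup>2 / 32))))"
      by (subst nn_integral_suminf) (auto simp: nn_integral_multc)
    finally have "(\<integral>\<^sup>+\<theta>. indicator U \<theta> * emeasure (?P \<theta>) (space \<mu> - T') \<partial>\<pi>) / ennreal (exp (- (C * a)) * measure \<pi> (S e)) \<le>
      (\<Sum>i. emeasure \<pi> (S ((real (J + i) + 1) * e)) * ennreal (exp (- (a * (real (J + i))\<^sup>2 / 32)))) /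
        ennreal (exp (- (C * a)) * measure \<pi> (S e))"
      by (rule divide_right_mono_ennreal)
    also have "\<dots> = (\<Sum>i. emeasure \<pi> (S ((real (J + i) + 1) * e)) * ennreal (exp (- (a * (real (J + i))\<^sup>2 / 32))) /
        ennreal (exp (- (C * a)) * measure \<pi> (S e)))"
      by (simp add: divide_ennreal_def)
    also have "\<dots> \<le> (\<Sum>i. ennreal (exp (- (c * real (J + i) / 256))))"
    proof (intro suminf_le summableI)
      fix i
      let ?x = "measure \<pi> (S ((real (J + i) + 1) * e))" and ?y = "exp (- (a * (real (J + i))\<^sup>2 / 32))"
      have B: "measure \<pi> (S e) > 0" using pos by (simp add: S_def)
      have "emeasure \<pi> (S ((real (J + i) + 1) * e)) * ennreal ?y / ennreal (exp (- (C * a)) * measure \<pi> (S e)) =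
          ennreal (?x * ?y / (exp (- (C * a)) * measure \<pi> (S e)))"
        using B by (simp add: \<pi>.emeasure_eq_measure divide_ennreal flip: ennreal_mult)
      also have "?x * ?y / (exp (- (C * a)) * measure \<pi> (S e)) = ?x / measure \<pi> (S e) * (?y * exp (C * a))"
        by (simp add: exp_minus field_simps)
      also have "\<dots> \<le> exp (a * (real (J + i + 1))\<^sup>2 / 64) * (?y * exp (C * a))"
        using ratio[of "J + i + 1"] by (intro mult_right_mono) (auto simp: S_def add_ac)
      also have "\<dots> = exp (a * (C + (real (J + i) + 1)\<^sup>2 / 64 - (real (J + i))\<^sup>2 / 32))"
        by (simp flip: exp_add) (simp add: algebra_simps)
      also have "\<dots> \<le> exp (- (c * real (J + i) / 256))" using exponent[of i] by simp
      finally show "emeasure \<pi> (S ((real (J + i) + 1) * e)) * ennreal ?y / ennreal (exp (- (C * a)) * measure \<pi> (S e))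
          \<le> ennreal (exp (- (c * real (J + i) / 256)))" by (simp add: ennreal_leI)
    qed
    finally show ?thesis unfolding suminf_exp_tail[OF ac(2)] .
  qed
  \<comment> \<open>With t = exp(-C a) and K = exp a, the product K t is exp(-(C - 1) a).\<close>
  have "(\<integral>\<^sup>+x. emeasure (posterior \<pi> p x) U \<partial>?P \<theta>0) \<le>
      emeasure (?P \<theta>0) T' + ennreal (exp a) * ennreal (exp (- (C * a))) +
      (\<integral>\<^sup>+\<theta>. indicator U \<theta> * emeasure (?P \<theta>) (space \<mu> - T') \<partial>\<pi>) / ennreal (exp (- (C * a)) * measure \<pi> (S e))"
  proof (rule posterior_mass_bound[OF \<pi> dens])
    show "\<theta>0 \<in> space \<pi>" using \<theta>0 space by simp
    show "prob_space (?P \<theta>0)" by (rule prob_space_white_noise_law[OF \<theta>0_L2])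
    show "measure \<pi> (S e) > 0" using pos by (simp add: S_def)
    show "T' \<in> sets \<mu>" using T' sets_\<mu> by simp
    fix \<theta> E assume \<theta>: "\<theta> \<in> S e" and E: "E \<in> sets \<mu>"
    then have "\<theta> \<in> L2_01" "?d \<theta> \<le> e" using \<Theta> by (auto simp: S_def)
    have "(emeasure (?P \<theta>0) E)\<^sup>2 \<le> ennreal (exp (real n * (l2_dist \<theta>0 \<theta>)\<^sup>2)) * emeasure (?P \<theta>) E"
      using E sets_\<mu> by (intro white_noise_law_shift_le n \<theta>0_L2 \<open>\<theta> \<in> L2_01\<close>) simp
    also have "\<dots> \<le> ennreal (exp a) * emeasure (?P \<theta>) E"
      unfolding a using \<open>?d \<theta> \<le> e\<close>
      by (intro mult_right_mono ennreal_leI exp_le_cancel_iff[THEN iffD2] mult_left_mono power_mono)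
        (auto simp: l2_dist_commute[of \<theta>0])
    finally show "(emeasure (?P \<theta>0) E)\<^sup>2 \<le> ennreal (exp a) * emeasure (?P \<theta>) E" .
  qed (use U S in simp_all)
  also have "\<dots> \<le> ennreal ?s + ennreal (exp (- ((C - 1) * c))) + ennreal ?s"
  proof (intro add_mono type1 type2)
    have "(C - 1) * c \<le> (C - 1) * a" using C ac by (intro mult_left_mono) auto
    then show "ennreal (exp a) * ennreal (exp (- (C * a))) \<le> ennreal (exp (- ((C - 1) * c)))"
      by (simp add: ennreal_leI algebra_simps flip: ennreal_mult exp_add)
  qed
  also have "\<dots> = ennreal (exp (- ((C - 1) * c)) + 2 * ?s)"
    using ac by (simp add: add_ac flip: ennreal_plus)
  finally show ?thesis unfolding U_def .
qed

theorem theorem6: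
  fixes M :: "'w measure" and W :: "real \<Rightarrow> 'w \<Rightarrow> real"
    and \<Theta> :: "(real \<Rightarrow> real) set" and \<theta>0 :: "real \<Rightarrow> real"
    and prior :: "nat \<Rightarrow> (real \<Rightarrow> real) measure"
    and \<mu> :: "nat \<Rightarrow> (real \<Rightarrow> real) measure"
    and p :: "nat \<Rightarrow> (real \<Rightarrow> real) \<Rightarrow> (real \<Rightarrow> real) \<Rightarrow> ennreal"
    and \<epsilon> :: "nat \<Rightarrow> real"
  assumes "standard_brownian_motion M W"
    and "\<Theta> \<subseteq> L2_01" and "\<theta>0 \<in> \<Theta>"
    and "\<And>n. n \<ge> 1 \<Longrightarrow> prob_space (prior n)"
    and "\<And>n. n \<ge> 1 \<Longrightarrow> space (prior n) = \<Theta>"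
    and "\<And>n. n \<ge> 1 \<Longrightarrow> (\<lambda>\<theta>. l2_dist \<theta> \<theta>0) \<in> borel_measurable (prior n)"
    and "\<And>n. n \<ge> 1 \<Longrightarrow> model_densities (\<mu> n) (prior n) (white_noise_law M W n) (p n)"
    and "\<And>n. n \<ge> 1 \<Longrightarrow> \<epsilon> n > 0"
    and "\<epsilon> \<longlonglongrightarrow> 0"
    and "(\<lambda>n. inverse (real n * (\<epsilon> n)\<^sup>2)) \<in> O(\<lambda>_. 1)"
    and "\<And>n. n \<ge> 1 \<Longrightarrow>
      (SUP \<delta> \<in> {\<epsilon> n<..}. ln_enat (l2_covering_number (\<delta> / 8) {\<theta> \<in> \<Theta>. l2_dist \<theta> \<theta>0 < \<delta>}))
        \<le> ereal (real n * (\<epsilon> n)\<^sup>2)"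
    and "\<And>n. n \<ge> 1 \<Longrightarrow> measure (prior n) {\<theta> \<in> \<Theta>. l2_dist \<theta> \<theta>0 \<le> \<epsilon> n} > 0"
    and "\<And>n j::nat. n \<ge> 1 \<Longrightarrow>
      measure (prior n) {\<theta> \<in> \<Theta>. l2_dist \<theta> \<theta>0 \<le> real j * \<epsilon> n} /
      measure (prior n) {\<theta> \<in> \<Theta>. l2_dist \<theta> \<theta>0 \<le> \<epsilon> n}
        \<le> exp (real n * (\<epsilon> n)\<^sup>2 * (real j)\<^sup>2 / 64)"
  shows "\<forall>m :: nat \<Rightarrow> real. filterlim m at_top sequentially \<longrightarrow>
    (\<lambda>n. \<integral>\<^sup>+x. emeasure (posterior (prior n) (p n) x) {\<theta> \<in> \<Theta>. l2_dist \<theta> \<theta>0 \<ge> m n * \<epsilon> n}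
           \<partial>white_noise_law M W n \<theta>0) \<longlonglongrightarrow> 0"
proof (intro allI impI)
  fix m :: "nat \<Rightarrow> real"
  assume m: "filterlim m at_top sequentially"
  let ?f = "\<lambda>n. \<integral>\<^sup>+x. emeasure (posterior (prior n) (p n) x) {\<theta> \<in> \<Theta>. l2_dist \<theta> \<theta>0 \<ge> m n * \<epsilon> n}
    \<partial>white_noise_law M W n \<theta>0"
  from assms(10) obtain K where K: "K > 0"
    "\<forall>\<^sub>F n in sequentially. norm (inverse (real n * (\<epsilon> n)\<^sup>2)) \<le> K * norm (1 :: real)"
    by (rule landau_o.bigE)
  \<comment> \<open>The O(1) condition says that n eps_n^2 is eventually at least this
    constant.\<close>
  define c where "c = inverse K"
  have c: "c > 0" using K(1) by (simp add: c_def)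
  have c_le: "\<forall>\<^sub>F n in sequentially. n \<ge> 1 \<and> c \<le> real n * (\<epsilon> n)\<^sup>2"
    using K(2) eventually_ge_at_top[of 1]
  proof eventually_elim
    case (elim n)
    then have "real n * (\<epsilon> n)\<^sup>2 > 0" using assms(8)[of n] by simp
    with elim K(1) show ?case by (simp add: c_def field_simps)
  qed
  have small: "\<forall>\<^sub>F n in sequentially. ?f n < ennreal r" if r: "r > 0" for r :: real
  proof -
    \<comment> \<open>The order of choices matters: C makes the first summand small, J is chosen in
      dependence on C to make the geometric tail small, and only then n is taken so large that m n
      >= J.\<close>
    have "((\<lambda>C. exp (- ((C - 1) * c))) \<longlongrightarrow> 0) at_top"
      using c by real_asymp
    then have "\<forall>\<^sub>F C in at_top. exp (- ((C - 1) * c)) < r / 2"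
      using r by (intro order_tendstoD(2)) auto
    then have "\<forall>\<^sub>F C in at_top. exp (- ((C - 1) * c)) < r / 2 \<and> 1 \<le> C"
      using eventually_ge_at_top[of 1] by (rule eventually_conj)
    then obtain C where C: "exp (- ((C - 1) * c)) < r / 2" "1 \<le> C"
      using eventually_happens'[OF trivial_limit_at_top_linorder] by blast
    define D where "D = 1 - exp (- (c / 256))"
    have D: "D > 0" using c by (simp add: D_def)
    have "(\<lambda>J. 2 * (exp (- (c * real J / 256)) / D)) \<longlonglongrightarrow> 0"
      using c D by real_asymp
    then have "\<forall>\<^sub>F J in sequentially. 2 * (exp (- (c * real J / 256)) / D) < r / 2"
      using r by (intro order_tendstoD(2)) auto
    moreover have "filterlim (\<lambda>J. (real J)\<^sup>2) at_top sequentially" by real_asymp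
    then have "\<forall>\<^sub>F J in sequentially. 256 * C \<le> (real J)\<^sup>2"
      by (simp add: filterlim_at_top)
    ultimately have "\<forall>\<^sub>F J in sequentially. 2 * (exp (- (c * real J / 256)) / D) < r / 2 \<and>
        256 * C \<le> (real J)\<^sup>2 \<and> 5 \<le> J"
      using eventually_ge_at_top[of 5] by eventually_elim auto
    then obtain J :: nat where J: "2 * (exp (- (c * real J / 256)) / D) < r / 2" "256 * C \<le> (real J)\<^sup>2" "5 \<le> J"
      using eventually_happens'[OF sequentially_bot] by blast
    have "\<forall>\<^sub>F n in sequentially. real J \<le> m n" using m by (simp add: filterlim_at_top)
    with c_le show ?thesis
    proof eventually_elim
      case (elim n)
      then have n: "n \<ge> 1" by simp
      have "?f n \<le> ennreal (exp (- ((C - 1) * c)) + 2 * (exp (- (c * real J / 256)) / (1 - exp (- (c / 256)))))"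
        by (rule white_noise_posterior_bound[OF assms(1-3) n assms(4)[OF n] assms(5)[OF n] assms(6)[OF n]
          assms(7)[OF n] assms(8)[OF n] refl _ c assms(11)[OF n] assms(12)[OF n] assms(13)[OF n] C(2) J(3) J(2)])
          (use elim in auto)
      also have "\<dots> < ennreal r"
        using C(1) J(1) r unfolding D_def by (intro ennreal_lessI) auto
      finally show ?case .
    qed
  qed
  show "?f \<longlonglongrightarrow> 0"
  proof (rule order_tendstoI)
    fix y :: ennreal assume "0 < y"
    \<comment> \<open>The bound \<open>y\<close> may be infinite, so a strictly smaller positive
      value, which is finite, takes its place.\<close>
    then obtain z where z: "0 < z" "z < y" using dense by blast
    then have "z < \<top>" by (meson le_less_trans less_top top_greatest less_le_trans)
    then obtain r where r: "z = ennreal r" "0 \<le> r" by (cases z) auto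
    with z(1) have "r > 0" by simp
    from small[OF this] show "\<forall>\<^sub>F n in sequentially. ?f n < y"
      by eventually_elim (use z(2) r(1) in auto)
  qed simp
qed

end
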